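(* For integers $p,k,m\in\mathbb{N}_0$ with $m\ge3$, $$\sum_{n\ge0}\left[\frac{4^n}{\binom{2n}{n}}\right]^2\frac{t^\star_n(1_k)\zeta_n(2_p)}{(2n+1)^m}\in\mathrm{CMZV}^4_{m+2p+k}.$$
   Context: For $n\in\mathbb{N}_0$: $t^\star_n(1_k)=\sum_{n\ge n_1\ge\cdots\ge n_k>0}\prod_j(2n_j-1)^{-1}$ and $\zeta_n(2_p)=\sum_{n\ge n_1>\cdots>n_p>0}\prod_j n_j^{-2}$, each equal to $1$ for the empty string and $0$ when the sum is empty. $\mathrm{CMZV}^4_w$ is the $\mathbb{Q}$-span of colored multiple zeta values $\sum_{n_1>\cdots>n_s>0}\prod_j z_j^{n_j}n_j^{-a_j}$ of weight $w$ with all $z_j$ fourth roots of unity and $(a_1,z_1)\ne(1,1)$. *)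

theory Defs
  imports "HOL-Analysis.Analysis"
begin

definition t_star_ones :: "nat \<Rightarrow> nat \<Rightarrow> real" where
  "t_star_ones n k =
     (\<Sum>ns | length ns = k \<and> sorted_wrt (\<ge>) ns \<and> set ns \<subseteq> {1..n}.
        \<Prod>j<k. inverse (2 * real (ns ! j) - 1))"

definition zeta_twos :: "nat \<Rightarrow> nat \<Rightarrow> real" where
  "zeta_twos n p =
     (\<Sum>ns | length ns = p \<and> sorted_wrt (>) ns \<and> set ns \<subseteq> {1..n}.
        \<Prod>j<p. inverse (real (ns ! j) ^ 2))"

text \<open>
  A colored multiple zeta value is given by the list of pairs
  \<open>[(a\<^sub>1, z\<^sub>1), \<dots>, (a\<^sub>s, z\<^sub>s)]\<close>, the pair of the largest summation index first.
\<close>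

definition cmzv_partial :: "(nat \<times> complex) list \<Rightarrow> nat \<Rightarrow> complex" where
  "cmzv_partial azs N =
     (\<Sum>ns | length ns = length azs \<and> sorted_wrt (>) ns \<and> set ns \<subseteq> {1..N}.
        \<Prod>j<length azs. snd (azs ! j) ^ (ns ! j) / of_nat (ns ! j) ^ fst (azs ! j))"

text \<open>
  The value is the limit over \<open>n\<^sub>1 \<le> N\<close>, \<open>N \<rightarrow> \<infinity>\<close>: if \<open>a\<^sub>1 = 1\<close> and \<open>z\<^sub>1 \<noteq> 1\<close>,
  the series converges only conditionally.
\<close>

definition cmzv :: "(nat \<times> complex) list \<Rightarrow> complex" where
  "cmzv azs = lim (cmzv_partial azs)"

definition cmzv_admissible :: "nat \<Rightarrow> (nat \<times> complex) list \<Rightarrow> bool" where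
  "cmzv_admissible L azs \<longleftrightarrow>
     (\<forall>(a, z) \<in> set azs. a \<ge> 1 \<and> z ^ L = 1) \<and> (azs \<noteq> [] \<longrightarrow> hd azs \<noteq> (1, 1))"

text \<open>The rational span of the colored multiple zeta values of level \<open>L\<close> and weight \<open>w\<close>.\<close>

definition CMZV :: "nat \<Rightarrow> nat \<Rightarrow> complex set" where
  "CMZV L w =
     module.span (\<lambda>(q::rat) (x::complex). of_rat q * x)
       {cmzv azs | azs. cmzv_admissible L azs \<and> sum_list (map fst azs) = w}"

end

(*
  Put A n = 4^n / (2n choose n), and let t = tan (alpha / 2). In the variable t each of the forms
  i d alpha, cot alpha d alpha, tan alpha d alpha and d alpha / sin alpha is a combination with
  coefficients 1 and -1 of dt/t and z dt/(1 - z t) with z^4 = 1, so iterated integrals of these forms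
  are rational combinations of polylogarithms of level 4 in t.

  The sum over n of A n zeta_n(2_p) sin(alpha)^(2n+1) / (2n+1) is 4^p alpha^(2p+1) / ((2p+1)! cos alpha),
  and each further division of the summands by 2n+1 is an integration against cot alpha d alpha.
  Integrating sin(alpha)^(2n+1) (- ln cos alpha)^k / k! over [0, pi/2] gives
  A n t*_(n+1)(1_k) / (2n+1). Hence the series with t*_(n+1) in place of t*_n is the value at
  alpha = pi/2 of an iterated integral whose powers of i combine to a real sign. As its outermost form
  is i d alpha, that is, z dt/(1 - z t) for z = i and z = -i only, the boundary values at t = 1 are
  convergent colored multiple zeta values and no regularization is needed. Finally,
  t*_n(1_k) = t*_(n+1)(1_k) - t*_(n+1)(1_(k-1)) / (2n+1).
*)
theory Submission
  imports Defs
begin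

text \<open>The shift to n + 1 comes from a Beta integral: the integral of sin(alpha)^(2n+1)
  cos(alpha)^(-s) over [0, pi/2] equals A n / (2n+1) times the product over 1 <= j <= n+1 of 1 / (1
  - s/(2j-1)). The coefficient of s^k in this product is t*_(n+1)(1_k); in the integrand it is
  sin(alpha)^(2n+1) (- ln cos alpha)^k / k!. The bound m >= 3 counts factors 2n+1: two are absorbed
  by the two copies of A n / (2n+1), and a third is spent on the factor 1 / cos alpha in the closed
  form of the sine series, which the first integration against cot alpha d alpha cancels, leaving d
  alpha / sin alpha. The analytic obstacle lies at t = 1: the coefficients decay only like powers of
  log n over n, so convergence may be conditional, and the inner forms may be singular there. A
  crude bound n^(-1/2) on the coefficients, stable under every integration used, suffices for a
  summation by parts once the outermost root differs from 1.\<close>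

unbundle no vec_syntax and fps_syntax

section \<open>Nested sums\<close>

text \<open>Split by the head: in a strictly decreasing list only the first entry can be
  \<open>Suc N\<close>, and then the tail lies in \<open>{1..N}\<close>. The nested sums are handled
  below through such recursions in the bound.\<close>

lemma sum_strict_lists_Suc:
  fixes \<Phi> :: "nat list \<Rightarrow> 'a::comm_monoid_add"
  shows "(\<Sum>ns | length ns = Suc k \<and> sorted_wrt (>) ns \<and> set ns \<subseteq> {1..Suc N}. \<Phi> ns) =
    (\<Sum>ns | length ns = Suc k \<and> sorted_wrt (>) ns \<and> set ns \<subseteq> {1..N}. \<Phi> ns) +
    (\<Sum>ns | length ns = k \<and> sorted_wrt (>) ns \<and> set ns \<subseteq> {1..N}. \<Phi> (Suc N # ns))"
proof -
  let ?S = "\<lambda>k N. {ns :: nat list. length ns = k \<and> sorted_wrt (>) ns \<and> set ns \<subseteq> {1..N}}"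
  have fin: "finite (?S k N)" for k N
    by (rule finite_subset[OF _ finite_lists_length_eq[of "{1..N}" k]]) auto
  have eq: "?S (Suc k) (Suc N) = ?S (Suc k) N \<union> (#) (Suc N) ` ?S k N"
  proof (intro set_eqI iffI)
    fix ns assume ns: "ns \<in> ?S (Suc k) (Suc N)"
    then obtain x xs where [simp]: "ns = x # xs" by (cases ns) auto
    show "ns \<in> ?S (Suc k) N \<union> (#) (Suc N) ` ?S k N"
    proof (cases "x = Suc N")
      case True
      with ns have "xs \<in> ?S k N" by (fastforce simp: subset_iff)
      with True show ?thesis by auto
    next
      case False
      with ns have "ns \<in> ?S (Suc k) N" by (fastforce simp: subset_iff)
      then show ?thesis by blast
    qed
  qed (fastforce simp: subset_iff less_Suc_eq_le)
  have "?S (Suc k) N \<inter> (#) (Suc N) ` ?S k N = {}" by fastforce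
  then show ?thesis
    by (subst eq, subst sum.union_disjoint)
       (use fin in \<open>auto simp: sum.reindex inj_on_def simp del: One_nat_def\<close>)
qed

text \<open>Now the entry \<open>Suc N\<close> may repeat, so after a head \<open>Suc N\<close> the
  tail still ranges up to \<open>Suc N\<close>. This is why the last term of
  \<open>t_star_ones_Suc_Suc\<close> keeps the index \<open>Suc n\<close>.\<close>

lemma sum_weak_lists_Suc:
  fixes \<Phi> :: "nat list \<Rightarrow> 'a::comm_monoid_add"
  shows "(\<Sum>ns | length ns = Suc k \<and> sorted_wrt (\<ge>) ns \<and> set ns \<subseteq> {1..Suc N}. \<Phi> ns) =
    (\<Sum>ns | length ns = Suc k \<and> sorted_wrt (\<ge>) ns \<and> set ns \<subseteq> {1..N}. \<Phi> ns) +
    (\<Sum>ns | length ns = k \<and> sorted_wrt (\<ge>) ns \<and> set ns \<subseteq> {1..Suc N}. \<Phi> (Suc N # ns))"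
proof -
  let ?S = "\<lambda>k N. {ns :: nat list. length ns = k \<and> sorted_wrt (\<ge>) ns \<and> set ns \<subseteq> {1..N}}"
  have fin: "finite (?S k N)" for k N
    by (rule finite_subset[OF _ finite_lists_length_eq[of "{1..N}" k]]) auto
  have eq: "?S (Suc k) (Suc N) = ?S (Suc k) N \<union> (#) (Suc N) ` ?S k (Suc N)"
  proof (intro set_eqI iffI)
    fix ns assume ns: "ns \<in> ?S (Suc k) (Suc N)"
    then obtain x xs where [simp]: "ns = x # xs" by (cases ns) auto
    show "ns \<in> ?S (Suc k) N \<union> (#) (Suc N) ` ?S k (Suc N)"
    proof (cases "x = Suc N")
      case True
      with ns show ?thesis by auto
    next
      case False
      with ns have "ns \<in> ?S (Suc k) N" by (fastforce simp: subset_iff)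
      then show ?thesis by blast
    qed
  qed (fastforce simp: subset_iff)
  have "?S (Suc k) N \<inter> (#) (Suc N) ` ?S k (Suc N) = {}" by fastforce
  then show ?thesis
    by (subst eq, subst sum.union_disjoint)
       (use fin in \<open>auto simp: sum.reindex inj_on_def simp del: One_nat_def\<close>)
qed

lemma zeta_twos_0_right [simp]: "zeta_twos n 0 = 1"
proof -
  have "{ns :: nat list. length ns = 0 \<and> sorted_wrt (>) ns \<and> set ns \<subseteq> {1..n}} = {[]}" by auto
  then show ?thesis by (simp add: zeta_twos_def)
qed

lemma zeta_twos_0_Suc [simp]: "zeta_twos 0 (Suc p) = 0"
proof -
  have "{ns :: nat list. length ns = Suc p \<and> sorted_wrt (>) ns \<and> set ns \<subseteq> {1..0}} = {}" by auto
  then show ?thesis by (simp only: zeta_twos_def sum.empty)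
qed

lemma zeta_twos_Suc_Suc:
  "zeta_twos (Suc n) (Suc p) = zeta_twos n (Suc p) + zeta_twos n p / (real n + 1)\<^sup>2"
  unfolding zeta_twos_def
  by (subst sum_strict_lists_Suc)
     (simp add: prod.lessThan_Suc_shift sum_divide_distrib divide_inverse mult_ac
        sum_distrib_left add_ac del: prod.lessThan_Suc)

lemma t_star_ones_0_right [simp]: "t_star_ones n 0 = 1"
proof -
  have "{ns :: nat list. length ns = 0 \<and> sorted_wrt (\<ge>) ns \<and> set ns \<subseteq> {1..n}} = {[]}" by auto
  then show ?thesis by (simp add: t_star_ones_def)
qed

lemma t_star_ones_0_Suc [simp]: "t_star_ones 0 (Suc k) = 0"
proof -
  have "{ns :: nat list. length ns = Suc k \<and> sorted_wrt (\<ge>) ns \<and> set ns \<subseteq> {1..0}} = {}" by auto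
  then show ?thesis by (simp only: t_star_ones_def sum.empty)
qed

lemma t_star_ones_Suc_Suc:
  "t_star_ones (Suc n) (Suc k) = t_star_ones n (Suc k) + t_star_ones (Suc n) k / (2 * real n + 1)"
  unfolding t_star_ones_def
  by (subst sum_weak_lists_Suc)
     (simp add: prod.lessThan_Suc_shift sum_divide_distrib divide_inverse mult_ac
        sum_distrib_left add_ac del: prod.lessThan_Suc)

lemma cmzv_partial_Nil [simp]: "cmzv_partial [] N = 1"
proof -
  have "{ns :: nat list. length ns = 0 \<and> sorted_wrt (>) ns \<and> set ns \<subseteq> {1..N}} = {[]}" by auto
  then show ?thesis by (simp add: cmzv_partial_def)
qed

lemma cmzv_partial_Cons_0 [simp]: "cmzv_partial (az # azs) 0 = 0"
proof -
  have "{ns :: nat list. length ns = length (az # azs) \<and> sorted_wrt (>) ns \<and> set ns \<subseteq> {1..0}} = {}"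
    by auto
  then show ?thesis by (simp only: cmzv_partial_def sum.empty)
qed

lemma cmzv_partial_Cons_Suc:
  "cmzv_partial ((a, z) # azs) (Suc N) =
     cmzv_partial ((a, z) # azs) N + z ^ Suc N / of_nat (Suc N) ^ a * cmzv_partial azs N"
  unfolding cmzv_partial_def length_Cons
  by (subst sum_strict_lists_Suc)
     (simp add: prod.lessThan_Suc_shift sum_distrib_left del: prod.lessThan_Suc power_Suc of_nat_Suc)

text \<open>A generating function in the largest index alone: the coefficient at \<open>n\<close>
  collects the terms with n_1 = n (the empty word sits at 0). Partial sums of coefficients are
  therefore \<open>cmzv_partial\<close>.\<close>

fun polylog_fps :: "(nat \<times> complex) list \<Rightarrow> complex fps" where
  "polylog_fps [] = 1"
| "polylog_fps ((a, z) # azs) = Abs_fps (\<lambda>n. z ^ n / of_nat n ^ a * (\<Sum>m<n. polylog_fps azs $ m))"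

lemma cmzv_partial_eq_sum: "cmzv_partial azs N = (\<Sum>n\<le>N. polylog_fps azs $ n)"
proof (induction azs arbitrary: N)
  case Nil
  then show ?case by (simp add: fps_one_nth)
next
  case (Cons az azs)
  obtain a z where [simp]: "az = (a, z)" by (cases az)
  show ?case
    by (induction N) (auto simp: cmzv_partial_Cons_Suc Cons lessThan_Suc_atMost
      simp del: power_Suc of_nat_Suc)
qed

section \<open>Polylogarithmic power series\<close>

text \<open>The inverse of t d/dt on series without constant term. Division by 0 turns the constant
  coefficient into 0, so the result is always the primitive that vanishes at 0.\<close>

definition fps_theta_inv :: "'a::field fps \<Rightarrow> 'a fps" where
  "fps_theta_inv h = Abs_fps (\<lambda>n. h $ n / of_nat n)"

definition fps_geo :: "'a::field \<Rightarrow> 'a fps" where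
  "fps_geo z = Abs_fps (\<lambda>n. if n = 0 then 0 else z ^ n)"

lemma fps_theta_inv_nth [simp]: "fps_theta_inv h $ n = h $ n / of_nat n"
  by (simp add: fps_theta_inv_def)

lemma fps_theta_inv_add: "fps_theta_inv (f + g) = fps_theta_inv f + fps_theta_inv g"
  by (simp add: fps_eq_iff add_divide_distrib)

lemma fps_theta_inv_diff: "fps_theta_inv (f - g) = fps_theta_inv f - fps_theta_inv g"
  by (simp add: fps_eq_iff diff_divide_distrib)

lemma fps_theta_inv_0 [simp]: "fps_theta_inv 0 = 0"
  by (simp add: fps_eq_iff)

lemma fps_theta_inv_const_mult:
  "fps_theta_inv (fps_const c * f) = fps_const c * fps_theta_inv f"
  by (simp add: fps_eq_iff)

lemma fps_theta_theta_inv: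
  fixes f :: "'a::field_char_0 fps"
  assumes "f $ 0 = 0"
  shows "fps_X * fps_deriv (fps_theta_inv f) = f"
  using assms by (auto simp: fps_eq_iff gr0_conv_Suc simp del: of_nat_Suc)

lemma fps_theta_inv_theta:
  fixes f :: "'a::field_char_0 fps"
  assumes "f $ 0 = 0"
  shows "fps_theta_inv (fps_X * fps_deriv f) = f"
  using assms by (auto simp: fps_eq_iff gr0_conv_Suc simp del: of_nat_Suc)

lemma fps_geo_nth_0 [simp]: "fps_geo z $ 0 = 0"
  by (simp add: fps_geo_def)

lemma fps_geo_nth_Suc [simp]: "fps_geo z $ Suc n = z ^ Suc n"
  by (simp add: fps_geo_def)

lemma fps_geo_mult_nth: "(fps_geo z * h) $ n = (\<Sum>m<n. z ^ (n - m) * h $ m)"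
proof -
  have "(fps_geo z * h) $ n = (\<Sum>m\<le>n. h $ m * fps_geo z $ (n - m))"
    by (subst mult.commute) (simp add: fps_mult_nth atMost_atLeast0)
  also have "\<dots> = (\<Sum>m<n. h $ m * fps_geo z $ (n - m))"
    by (subst lessThan_Suc_atMost[symmetric], subst sum.lessThan_Suc) simp
  finally show ?thesis by (simp add: fps_geo_def mult.commute)
qed

lemma fps_geo_mult_nth_Suc:
  "(fps_geo z * h) $ Suc n = z * ((fps_geo z * h) $ n + h $ n)"
  unfolding fps_geo_mult_nth by (simp add: sum_distrib_left algebra_simps Suc_diff_le)

text \<open>
  As \<open>fps_theta_inv\<close> integrates against \<open>dt/t\<close> and \<open>fps_geo z\<close> is \<open>z t / (1 - z t)\<close>, these are the
  iterated integrals of \<open>dt/t\<close> and \<open>z dt / (1 - z t)\<close> with \<open>z ^ L = 1\<close>. The condition on \<open>g0\<close> is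
  vacuous except in weight 1.
\<close>

primrec polylogs :: "nat \<Rightarrow> nat \<Rightarrow> complex fps set" where
  "polylogs L 0 = range (\<lambda>q. fps_const (of_rat q))"
| "polylogs L (Suc w) =
     {fps_theta_inv (g0 + (\<Sum>z | z ^ L = 1. fps_geo z * g z)) | g0 g.
        g0 \<in> polylogs L w \<and> g0 $ 0 = 0 \<and> (\<forall>z. g z \<in> polylogs L w)}"

lemma polylogs_SucI:
  assumes "f = fps_theta_inv (g0 + (\<Sum>z | z ^ L = 1. fps_geo z * g z))"
    and "g0 \<in> polylogs L w" "g0 $ 0 = 0" "\<And>z. g z \<in> polylogs L w"
  shows "f \<in> polylogs L (Suc w)"
  using assms unfolding polylogs.simps by blast

lemma polylogs_SucE:
  assumes "f \<in> polylogs L (Suc w)"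
  obtains g0 g where "f = fps_theta_inv (g0 + (\<Sum>z | z ^ L = 1. fps_geo z * g z))"
    "g0 \<in> polylogs L w" "g0 $ 0 = 0" "\<And>z. g z \<in> polylogs L w"
  using assms unfolding polylogs.simps by blast

declare polylogs.simps(2) [simp del]

lemma polylogs_add: "f \<in> polylogs L w \<Longrightarrow> g \<in> polylogs L w \<Longrightarrow> f + g \<in> polylogs L w"
proof (induction w arbitrary: f g)
  case 0
  then obtain q r where "f = fps_const (of_rat q)" "g = fps_const (of_rat r)" by auto
  then have "f + g = fps_const (of_rat (q + r))" by (simp add: of_rat_add)
  then show ?case by auto
next
  case (Suc w)
  obtain f0 f1 where f: "f = fps_theta_inv (f0 + (\<Sum>z | z ^ L = 1. fps_geo z * f1 z))"
    "f0 \<in> polylogs L w" "f0 $ 0 = 0" "\<And>z. f1 z \<in> polylogs L w"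
    using Suc.prems(1) by (rule polylogs_SucE) blast
  obtain g0 g1 where g: "g = fps_theta_inv (g0 + (\<Sum>z | z ^ L = 1. fps_geo z * g1 z))"
    "g0 \<in> polylogs L w" "g0 $ 0 = 0" "\<And>z. g1 z \<in> polylogs L w"
    using Suc.prems(2) by (rule polylogs_SucE) blast
  have "f + g = fps_theta_inv ((f0 + g0) + (\<Sum>z | z ^ L = 1. fps_geo z * (f1 z + g1 z)))"
    by (simp add: f(1) g(1) sum.distrib algebra_simps flip: fps_theta_inv_add)
  then show ?case
    by (rule polylogs_SucI) (use f g Suc.IH in auto)
qed

lemma polylogs_scale: "f \<in> polylogs L w \<Longrightarrow> fps_const (of_rat q) * f \<in> polylogs L w"
proof (induction w arbitrary: f)
  case 0
  then obtain r where "f = fps_const (of_rat r)" by auto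
  then have "fps_const (of_rat q) * f = fps_const (of_rat (q * r))" by (simp add: of_rat_mult)
  then show ?case by auto
next
  case (Suc w)
  let ?q = "fps_const (of_rat q)"
  obtain f0 f1 where f: "f = fps_theta_inv (f0 + (\<Sum>z | z ^ L = 1. fps_geo z * f1 z))"
    "f0 \<in> polylogs L w" "f0 $ 0 = 0" "\<And>z. f1 z \<in> polylogs L w"
    using Suc.prems by (rule polylogs_SucE) blast
  have "?q * f = fps_theta_inv (?q * f0 + (\<Sum>z | z ^ L = 1. fps_geo z * (?q * f1 z)))"
    by (simp add: f(1) sum_distrib_left algebra_simps flip: fps_theta_inv_const_mult)
  then show ?case
    by (rule polylogs_SucI) (use f Suc.IH in auto)
qed

lemma zero_in_polylogs [simp]: "0 \<in> polylogs L w"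
proof (induction w)
  case 0
  have "0 = fps_const (complex_of_rat 0)" by simp
  then show ?case unfolding polylogs.simps by blast
next
  case (Suc w)
  show ?case by (rule polylogs_SucI[where ?g0.0 = 0 and g = "\<lambda>_. 0"]) (use Suc in auto)
qed

lemma polylogs_uminus: "f \<in> polylogs L w \<Longrightarrow> - f \<in> polylogs L w"
  using polylogs_scale[of f L w "-1"] by (simp flip: fps_const_neg)

lemma polylogs_diff: "f \<in> polylogs L w \<Longrightarrow> g \<in> polylogs L w \<Longrightarrow> f - g \<in> polylogs L w"
  using polylogs_add[OF _ polylogs_uminus, of f L w g] by simp

lemma polylogs_theta_inv:
  assumes "g \<in> polylogs L w" "g $ 0 = 0"
  shows "fps_theta_inv g \<in> polylogs L (Suc w)"
  by (rule polylogs_SucI[where ?g0.0 = g and g = "\<lambda>_. 0"]) (use assms in auto)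

lemma polylogs_theta_inv_geo:
  assumes "g \<in> polylogs L w" "z ^ L = 1" "L > 0"
  shows "fps_theta_inv (fps_geo z * g) \<in> polylogs L (Suc w)"
proof -
  have "finite {z::complex. z ^ L = 1}"
    using assms by (intro finite_roots_unity) auto
  then have "(\<Sum>y | y ^ L = 1. fps_geo y * (if y = z then g else 0)) = fps_geo z * g"
    using assms by (simp add: if_distrib sum.delta cong: if_cong)
  then show ?thesis
    by (intro polylogs_SucI[where ?g0.0 = 0 and g = "\<lambda>y. if y = z then g else 0"]) (use assms in auto)
qed

text \<open>The shuffle product of iterated integrals: t d/dt is a derivation, so differentiating a
  product lowers the weight of one factor by one and leaves an integrand of the required shape.
  Hence induction on the total weight.\<close>

lemma polylogs_mult:
  "f \<in> polylogs L w \<Longrightarrow> g \<in> polylogs L v \<Longrightarrow> f * g \<in> polylogs L (w + v)"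
proof (induction "w + v" arbitrary: w v f g rule: less_induct)
  case less
  show ?case
  proof (cases "w = 0 \<or> v = 0")
    case True
    then show ?thesis
    proof
      assume "w = 0"
      with less.prems show ?thesis by (auto intro: polylogs_scale)
    next
      assume "v = 0"
      with less.prems show ?thesis
        by (subst mult.commute) (auto intro: polylogs_scale)
    qed
  next
    case False
    then obtain w' v' where w: "w = Suc w'" and v: "v = Suc v'"
      by (auto simp: gr0_conv_Suc)
    obtain f0 f1 where f: "f = fps_theta_inv (f0 + (\<Sum>z | z ^ L = 1. fps_geo z * f1 z))"
      "f0 \<in> polylogs L w'" "f0 $ 0 = 0" "\<And>z. f1 z \<in> polylogs L w'"
      using less.prems(1) unfolding w by (rule polylogs_SucE) blast
    obtain g0 g1 where g: "g = fps_theta_inv (g0 + (\<Sum>z | z ^ L = 1. fps_geo z * g1 z))"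
      "g0 \<in> polylogs L v'" "g0 $ 0 = 0" "\<And>z. g1 z \<in> polylogs L v'"
      using less.prems(2) unfolding v by (rule polylogs_SucE) blast
    have f': "fps_X * fps_deriv f = f0 + (\<Sum>z | z ^ L = 1. fps_geo z * f1 z)"
      unfolding f(1) by (rule fps_theta_theta_inv) (simp add: f fps_sum_nth)
    have g': "fps_X * fps_deriv g = g0 + (\<Sum>z | z ^ L = 1. fps_geo z * g1 z)"
      unfolding g(1) by (rule fps_theta_theta_inv) (simp add: g fps_sum_nth)
    have fg0: "f $ 0 = 0" "g $ 0 = 0" by (simp_all add: f(1) g(1))
    \<comment> \<open>Both weights are positive here, so both factors vanish at 0 and the product is
      recovered from its derivative.\<close>
    have "f * g = fps_theta_inv (fps_X * fps_deriv (f * g))"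
      using fg0 by (subst fps_theta_inv_theta) auto
    also have "fps_X * fps_deriv (f * g) = (fps_X * fps_deriv f) * g + f * (fps_X * fps_deriv g)"
      by (simp add: algebra_simps)
    also have "\<dots> = (f0 * g + f * g0) + (\<Sum>z | z ^ L = 1. fps_geo z * (f1 z * g + f * g1 z))"
      unfolding f' g' by (simp add: sum_distrib_left sum_distrib_right sum.distrib algebra_simps)
    finally have eq: "f * g = fps_theta_inv \<dots>" .
    have 1: "a * g \<in> polylogs L (w' + v)" if "a \<in> polylogs L w'" for a
      using less.hyps[of w' v a g] less.prems(2) that w by simp
    have 2: "f * a \<in> polylogs L (w' + v)" if "a \<in> polylogs L v'" for a
      using less.hyps[of w v' f a] less.prems(1) that w v by simp
    have "f * g \<in> polylogs L (Suc (w' + v))"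
      by (rule polylogs_SucI[OF eq]) (intro polylogs_add 1 2 f g | simp add: f(3) fg0 g(3))+
    then show ?thesis by (simp add: w)
  qed
qed

section \<open>Iterated integrals as rational combinations of nested sums\<close>

interpretation rat_fps: module "\<lambda>(q::rat) (f::complex fps). fps_const (of_rat q) * f"
  by unfold_locales
     (simp_all add: algebra_simps of_rat_add of_rat_mult flip: fps_const_add fps_const_mult)

text \<open>The same scalar action as in \<open>CMZV\<close>, so that the span in that definition is
  \<open>rat_complex.span\<close>.\<close>

interpretation rat_complex: module "\<lambda>(q::rat) (x::complex). of_rat q * x"
  by unfold_locales (simp_all add: algebra_simps of_rat_add of_rat_mult)

definition polylog_words :: "nat \<Rightarrow> nat \<Rightarrow> (nat \<times> complex) list set" where
  "polylog_words L w =
     {azs. (\<forall>(a, z) \<in> set azs. a \<ge> 1 \<and> z ^ L = 1) \<and> sum_list (map fst azs) = w}"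

text \<open>Dividing the first root by \<open>z\<close> divides the \<open>n\<close>-th coefficient of the polylogarithm by \<open>z ^ n\<close>.\<close>

fun twist_word :: "complex \<Rightarrow> (nat \<times> complex) list \<Rightarrow> (nat \<times> complex) list" where
  "twist_word z [] = []"
| "twist_word z ((a, y) # azs) = (a, y / z) # azs"

lemma twist_word_in_polylog_words:
  "azs \<in> polylog_words L w \<Longrightarrow> z ^ L = 1 \<Longrightarrow> twist_word z azs \<in> polylog_words L w"
  by (cases "(z, azs)" rule: twist_word.cases) (auto simp: polylog_words_def power_divide)

text \<open>Multiplication by \<open>fps_geo z\<close> weights the gap n - m between consecutive
  indices, whereas a colored multiple zeta value attaches a root to each index. Splitting
  \<open>z ^ (n - m)\<close> passes from one convention to the other; for the empty word only m = 0
  contributes.\<close>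

lemma polylog_fps_twist:
  assumes "z \<noteq> 0" "m \<le> n"
  shows "z ^ (n - m) * polylog_fps azs $ m = z ^ n * polylog_fps (twist_word z azs) $ m"
  using assms
  by (cases "(z, azs)" rule: twist_word.cases) (auto simp: power_diff power_divide)

lemma fps_theta_inv_polylog:
  "fps_theta_inv (polylog_fps ((a, z) # azs)) = polylog_fps ((Suc a, z) # azs)"
  by (simp add: fps_eq_iff)

lemma fps_theta_inv_geo_polylog:
  assumes "z \<noteq> 0"
  shows "fps_theta_inv (fps_geo z * polylog_fps azs) = polylog_fps ((1, z) # twist_word z azs)"
proof (rule fps_ext)
  fix n
  have "(\<Sum>m<n. z ^ (n - m) * polylog_fps azs $ m) =
      (\<Sum>m<n. z ^ n * polylog_fps (twist_word z azs) $ m)"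
    by (intro sum.cong refl polylog_fps_twist) (use assms in auto)
  then show "fps_theta_inv (fps_geo z * polylog_fps azs) $ n =
      polylog_fps ((1, z) # twist_word z azs) $ n"
    by (simp add: fps_geo_mult_nth sum_distrib_left sum_divide_distrib)
qed

text \<open>Integration against dt/t raises the leading exponent of a word; integration against z
  dt/(1 - z t) prepends the pair (1, z) and twists the rest.\<close>

lemma polylogs_subset_span:
  assumes "L > 0"
  shows "polylogs L w \<subseteq> rat_fps.span (polylog_fps ` polylog_words L w)"
proof (induction w)
  case 0
  have "polylog_fps [] \<in> polylog_fps ` polylog_words L 0"
    by (intro imageI) (simp add: polylog_words_def)
  then have "fps_const (of_rat q) * polylog_fps [] \<in>
      rat_fps.span (polylog_fps ` polylog_words L 0)" for q
    by (intro rat_fps.span_scale rat_fps.span_base)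
  then show ?case by auto
next
  case (Suc w)
  let ?S = "\<lambda>w. rat_fps.span (polylog_fps ` polylog_words L w)"
  have 1: "fps_theta_inv g \<in> ?S (Suc w)" if "g \<in> ?S w" for g
    using that
  proof (induction rule: rat_fps.span_induct_alt)
    case base
    then show ?case by (simp add: rat_fps.span_zero)
  next
    case (step c x y)
    from step obtain azs where azs: "azs \<in> polylog_words L w" "x = polylog_fps azs" by auto
    have "fps_theta_inv x \<in> ?S (Suc w)"
    proof (cases azs)
      \<comment> \<open>The empty word is the constant 1, which \<open>fps_theta_inv\<close> sends
        to 0 because of the division by 0.\<close>
      case Nil
      then have "fps_theta_inv x = 0" by (simp add: azs fps_eq_iff fps_one_nth)
      then show ?thesis by (simp add: rat_fps.span_zero)
    next
      case (Cons az azs')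
      obtain a z where az: "az = (a, z)" by (cases az)
      from azs(1) Cons az have "(Suc a, z) # azs' \<in> polylog_words L (Suc w)"
        by (auto simp: polylog_words_def)
      then show ?thesis
        unfolding azs Cons az fps_theta_inv_polylog by (intro rat_fps.span_base imageI)
    qed
    with step show ?case
      by (auto simp: fps_theta_inv_add fps_theta_inv_const_mult
        intro!: rat_fps.span_add rat_fps.span_scale)
  qed
  have 2: "fps_theta_inv (fps_geo z * g) \<in> ?S (Suc w)" if "g \<in> ?S w" "z ^ L = 1" for g z
    using that(1)
  proof (induction rule: rat_fps.span_induct_alt)
    case base
    then show ?case by (simp add: rat_fps.span_zero)
  next
    case (step c x y)
    from step obtain azs where azs: "azs \<in> polylog_words L w" "x = polylog_fps azs" by auto
    have "z \<noteq> 0" using that(2) assms by (auto simp: zero_power)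
    moreover have "(1, z) # twist_word z azs \<in> polylog_words L (Suc w)"
      using twist_word_in_polylog_words[OF azs(1) that(2)] that(2) by (auto simp: polylog_words_def)
    ultimately have "fps_theta_inv (fps_geo z * x) \<in> ?S (Suc w)"
      unfolding azs(2) using fps_theta_inv_geo_polylog by (metis imageI rat_fps.span_base)
    moreover have "fps_theta_inv (fps_geo z * (fps_const (of_rat c) * x + y)) =
        fps_const (of_rat c) * fps_theta_inv (fps_geo z * x) + fps_theta_inv (fps_geo z * y)"
      by (simp add: algebra_simps flip: fps_theta_inv_add fps_theta_inv_const_mult)
    ultimately show ?case
      using step by (auto intro!: rat_fps.span_add rat_fps.span_scale)
  qed
  show ?case
  proof
    fix f assume "f \<in> polylogs L (Suc w)"
    then obtain g0 g where f: "f = fps_theta_inv (g0 + (\<Sum>z | z ^ L = 1. fps_geo z * g z))"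
      "g0 \<in> polylogs L w" "g0 $ 0 = 0" "\<And>z. g z \<in> polylogs L w"
      by (rule polylogs_SucE) blast
    have "f = fps_theta_inv g0 + (\<Sum>z | z ^ L = 1. fps_theta_inv (fps_geo z * g z))"
      by (simp add: f(1) fps_eq_iff fps_sum_nth add_divide_distrib sum_divide_distrib)
    moreover have "fps_theta_inv g0 \<in> ?S (Suc w)"
      using f Suc.IH by (intro 1) auto
    moreover have "fps_theta_inv (fps_geo z * g z) \<in> ?S (Suc w)" if "z ^ L = 1" for z
      using f(4)[of z] Suc.IH that by (intro 2) auto
    ultimately show "f \<in> ?S (Suc w)"
      by (auto intro!: rat_fps.span_add rat_fps.span_sum)
  qed
qed

section \<open>Boundary values\<close>

text \<open>The true size of the coefficients is a power of log n over n. The weaker n^(-1/2) avoids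
  tracking logarithms: its partial sums are O(n^(1/2)), and division by n restores the
  bound.\<close>

definition sqrt_bounded :: "complex fps \<Rightarrow> bool" where
  "sqrt_bounded h \<longleftrightarrow> (\<exists>K\<ge>0. \<forall>n>0. norm (h $ n) \<le> K / sqrt (real n))"

lemma sqrt_bounded_0 [simp]: "sqrt_bounded 0"
  by (auto simp: sqrt_bounded_def intro: exI[of _ 0])

lemma sqrt_bounded_const: "sqrt_bounded (fps_const c)"
  by (auto simp: sqrt_bounded_def intro: exI[of _ 0])

lemma sqrt_bounded_add:
  assumes "sqrt_bounded f" "sqrt_bounded g"
  shows "sqrt_bounded (f + g)"
proof -
  obtain K K' where K: "K \<ge> 0" "K' \<ge> 0" "\<And>n. n > 0 \<Longrightarrow> norm (f $ n) \<le> K / sqrt (real n)"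
    "\<And>n. n > 0 \<Longrightarrow> norm (g $ n) \<le> K' / sqrt (real n)"
    using assms unfolding sqrt_bounded_def by blast
  have "norm ((f + g) $ n) \<le> (K + K') / sqrt (real n)" if "n > 0" for n
    using norm_triangle_ineq[of "f $ n" "g $ n"] K(3,4)[OF that] by (simp add: add_divide_distrib)
  with K show ?thesis unfolding sqrt_bounded_def by (intro exI[of _ "K + K'"]) auto
qed

lemma sqrt_bounded_const_mult:
  assumes "sqrt_bounded f"
  shows "sqrt_bounded (fps_const c * f)"
proof -
  obtain K where K: "K \<ge> 0" "\<And>n. n > 0 \<Longrightarrow> norm (f $ n) \<le> K / sqrt (real n)"
    using assms unfolding sqrt_bounded_def by blast
  have "norm ((fps_const c * f) $ n) \<le> norm c * K / sqrt (real n)" if "n > 0" for n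
    using mult_left_mono[OF K(2)[OF that], of "norm c"] by (simp add: norm_mult)
  with K show ?thesis unfolding sqrt_bounded_def by (intro exI[of _ "norm c * K"]) auto
qed

lemma sqrt_bounded_sum: "(\<And>x. x \<in> A \<Longrightarrow> sqrt_bounded (f x)) \<Longrightarrow> sqrt_bounded (sum f A)"
  by (induction A rule: infinite_finite_induct) (auto intro: sqrt_bounded_add)

lemma sqrt_bounded_theta_inv:
  assumes "sqrt_bounded f"
  shows "sqrt_bounded (fps_theta_inv f)"
proof -
  obtain K where K: "K \<ge> 0" "\<And>n. n > 0 \<Longrightarrow> norm (f $ n) \<le> K / sqrt (real n)"
    using assms unfolding sqrt_bounded_def by blast
  have "norm (fps_theta_inv f $ n) \<le> K / sqrt (real n)" if "n > 0" for n
  proof -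
    have "norm (fps_theta_inv f $ n) = norm (f $ n) / real n" by (simp add: norm_divide)
    also have "\<dots> \<le> norm (f $ n) / 1" using that by (intro divide_left_mono) auto
    finally show ?thesis using K(2)[OF that] by simp
  qed
  with K show ?thesis unfolding sqrt_bounded_def by auto
qed

text \<open>As z lies on the unit circle, each step of the recursion for the coefficients adds at
  most the norm of one coefficient of f, and the sum of K / sqrt m for m up to n is at most 2 K sqrt
  n.\<close>

lemma sqrt_bounded_geo_mult:
  assumes "sqrt_bounded f" "norm z = 1"
  obtains C where "C \<ge> 0" "\<And>n. norm ((fps_geo z * f) $ n) \<le> C * sqrt (real n)"
proof -
  obtain K where K: "K \<ge> 0" "\<And>n. n > 0 \<Longrightarrow> norm (f $ n) \<le> K / sqrt (real n)"
    using assms unfolding sqrt_bounded_def by blast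
  let ?s = "fps_geo z * f"
  have s: "norm (?s $ Suc n) \<le> norm (f $ 0) + 2 * K * sqrt (real n)" for n
  proof (induction n)
    case 0
    then show ?case
      using assms by (simp add: norm_mult)
  next
    case (Suc n)
    have "norm (?s $ Suc (Suc n)) \<le> norm (?s $ Suc n) + norm (f $ Suc n)"
      by (subst fps_geo_mult_nth_Suc) (simp add: norm_mult assms norm_triangle_ineq)
    also have "\<dots> \<le> norm (f $ 0) + 2 * K * sqrt (real n) + K / sqrt (real (Suc n))"
      using Suc K(2)[of "Suc n"] by simp
    \<comment> \<open>A telescoping majorant, obtained by expanding the square of the difference of
      the two roots.\<close>
    also have "1 / sqrt (real (Suc n)) \<le> 2 * (sqrt (real (Suc n)) - sqrt (real n))"
    proof -
      have "0 \<le> (sqrt (real (Suc n)) - sqrt (real n))\<^sup>2" by simp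
      then have "1 \<le> 2 * (sqrt (real (Suc n)) - sqrt (real n)) * sqrt (real (Suc n))"
        by (simp add: power2_diff algebra_simps)
      then show ?thesis by (simp add: divide_simps)
    qed
    then have "K / sqrt (real (Suc n)) \<le> K * (2 * (sqrt (real (Suc n)) - sqrt (real n)))"
      using K(1) mult_left_mono by fastforce
    finally show ?case by (simp add: algebra_simps)
  qed
  have "norm (?s $ n) \<le> (norm (f $ 0) + 2 * K) * sqrt (real n)" for n
  proof (cases n)
    case 0
    then show ?thesis by simp
  next
    case (Suc m)
    have "norm (?s $ n) \<le> norm (f $ 0) * 1 + 2 * K * sqrt (real m)" using s[of m] Suc by simp
    also have "\<dots> \<le> norm (f $ 0) * sqrt (real n) + 2 * K * sqrt (real n)"
      using K Suc by (intro add_mono mult_left_mono) auto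
    finally show ?thesis by (simp add: algebra_simps)
  qed
  with K that show thesis by (metis add_nonneg_nonneg mult_nonneg_nonneg norm_ge_zero zero_le_numeral)
qed

lemma sqrt_bounded_theta_inv_geo:
  assumes "sqrt_bounded f" "norm z = 1"
  shows "sqrt_bounded (fps_theta_inv (fps_geo z * f))"
proof -
  obtain C where C: "C \<ge> 0" "\<And>n. norm ((fps_geo z * f) $ n) \<le> C * sqrt (real n)"
    using sqrt_bounded_geo_mult[OF assms] by blast
  have "norm (fps_theta_inv (fps_geo z * f) $ n) \<le> C / sqrt (real n)" if "n > 0" for n
  proof -
    have "norm (fps_theta_inv (fps_geo z * f) $ n) \<le> C * sqrt (real n) / real n"
      using C(2)[of n] by (simp add: norm_divide divide_right_mono)
    also have "\<dots> = C / sqrt (real n)"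
      using that by (simp add: field_simps)
    finally show ?thesis .
  qed
  with C show ?thesis unfolding sqrt_bounded_def by auto
qed

lemma norm_root_of_unity:
  fixes z :: complex
  assumes "z ^ L = 1" "L > 0"
  shows "norm z = 1"
  using power_eq_1_iff[OF assms(1)] assms(2) by simp

lemma sqrt_bounded_polylogs:
  assumes "L > 0" "f \<in> polylogs L w"
  shows "sqrt_bounded f"
  using assms(2)
proof (induction w arbitrary: f)
  case 0
  then show ?case by (auto simp: sqrt_bounded_const)
next
  case (Suc w)
  obtain g0 g where f: "f = fps_theta_inv (g0 + (\<Sum>z | z ^ L = 1. fps_geo z * g z))"
    "g0 \<in> polylogs L w" "g0 $ 0 = 0" "\<And>z. g z \<in> polylogs L w"
    using Suc.prems by (rule polylogs_SucE) blast
  have "f = fps_theta_inv g0 + (\<Sum>z | z ^ L = 1. fps_theta_inv (fps_geo z * g z))"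
    by (simp add: f(1) fps_eq_iff fps_sum_nth add_divide_distrib sum_divide_distrib)
  moreover have "sqrt_bounded (fps_theta_inv g0)"
    using f Suc.IH by (intro sqrt_bounded_theta_inv)
  moreover have "sqrt_bounded (fps_theta_inv (fps_geo z * g z))" if "z ^ L = 1" for z
    using Suc.IH[OF f(4)] norm_root_of_unity[OF that assms(1)]
    by (intro sqrt_bounded_theta_inv_geo)
  ultimately show ?case
    by (auto intro!: sqrt_bounded_add sqrt_bounded_sum)
qed

text \<open>Complements \<open>sqrt_bounded_polylogs\<close>: boundary values are computed word by
  word, and a single word has not been shown to lie in \<open>polylogs\<close>.\<close>

lemma sqrt_bounded_polylog_fps:
  assumes "L > 0" "azs \<in> polylog_words L w"
  shows "sqrt_bounded (polylog_fps azs)"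
  using assms(2)
proof (induction azs arbitrary: w)
  case Nil
  then show ?case using sqrt_bounded_const[of 1] by simp
next
  case (Cons az azs)
  obtain a z where az: "az = (a, z)" by (cases az)
  have a: "a \<ge> 1" and z: "z ^ L = 1" and azs: "azs \<in> polylog_words L (w - a)"
    using Cons.prems by (auto simp: polylog_words_def az)
  \<comment> \<open>At the root 1 the product with \<open>fps_geo\<close> forms plain partial sums
    of the coefficients.\<close>
  obtain C where C: "C \<ge> 0"
    "\<And>n. norm ((fps_geo 1 * polylog_fps azs) $ n) \<le> C * sqrt (real n)"
    using sqrt_bounded_geo_mult[OF Cons.IH[OF azs], of 1] by auto
  have "norm (polylog_fps ((a, z) # azs) $ n) \<le> C / sqrt (real n)" if "n > 0" for n
  proof -
    have "norm (polylog_fps ((a, z) # azs) $ n) = norm (\<Sum>m<n. polylog_fps azs $ m) / real n ^ a"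
      by (simp add: norm_mult norm_divide norm_power norm_root_of_unity[OF z assms(1)])
    also have "\<dots> \<le> (C * sqrt (real n)) / real n ^ 1"
      using C(2)[of n] C(1) a that
      by (intro frac_le power_increasing) (auto simp: fps_geo_mult_nth)
    also have "\<dots> = C / sqrt (real n)"
      using that by (simp add: field_simps)
    finally show ?thesis .
  qed
  with C(1) show ?case unfolding sqrt_bounded_def az by blast
qed

section \<open>Radii of convergence and Abel limits at t = 1\<close>

lemma fps_conv_radius_ge_1:
  fixes f :: "'a::{banach,real_normed_field} fps"
  assumes "\<And>n. norm (f $ n) \<le> C * (real n + 1)"
  shows "fps_conv_radius f \<ge> 1"
  unfolding fps_conv_radius_def
proof (rule conv_radius_geI_ex)
  fix r :: real assume r: "0 < r" "ereal r < 1"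
  then have "summable (\<lambda>n. C * (of_nat (Suc n) * r ^ n))"
    using geometric_deriv_sums[of r] by (intro summable_mult) (auto simp: sums_iff)
  then have "summable (\<lambda>n. f $ n * of_real r ^ n)"
    by (rule summable_comparison_test'[where N = 0])
       (use assms r in \<open>auto simp: norm_mult norm_power mult.assoc[symmetric] add.commute
          intro!: mult_right_mono\<close>)
  then show "\<exists>z. norm z = r \<and> summable (\<lambda>n. f $ n * z ^ n)"
    using r by (intro exI[of _ "of_real r"]) auto
qed

lemma sqrt_bounded_conv_radius:
  assumes "sqrt_bounded f"
  shows "fps_conv_radius f \<ge> 1"
proof -
  obtain K where K: "K \<ge> 0" "\<And>n. n > 0 \<Longrightarrow> norm (f $ n) \<le> K / sqrt (real n)"
    using assms unfolding sqrt_bounded_def by blast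
  have "norm (f $ n) \<le> (K + norm (f $ 0)) * (real n + 1)" for n
  proof (cases "n = 0")
    case False
    have "norm (f $ n) \<le> K / sqrt (real n)" using K False by simp
    also have "\<dots> \<le> K / 1" using False K by (intro divide_left_mono) auto
    also have "\<dots> \<le> (K + norm (f $ 0)) * (real n + 1)"
      using K(1) by (simp add: algebra_simps)
    finally show ?thesis .
  qed (use K in auto)
  then show ?thesis by (rule fps_conv_radius_ge_1)
qed

lemma abel_limit_abs_summable:
  fixes f :: "complex fps"
  assumes "summable (\<lambda>n. norm (f $ n))"
  shows "((\<lambda>t. eval_fps f (of_real t)) \<longlongrightarrow> (\<Sum>n. f $ n)) (at_left 1)"
proof -
  have *: "((\<lambda>t. f $ n * of_real t ^ n) \<longlongrightarrow> f $ n) (at_left (1::real))" for n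
    by (rule tendsto_eq_intros refl | simp)+
  have "eventually (\<lambda>t::real. 0 < t \<and> t < 1) (at_left 1)"
    using eventually_at_left_real[of 0 1] by (auto elim: eventually_mono)
  then have "eventually (\<lambda>(n, t). norm (f $ n * of_real t ^ n) \<le> norm (f $ n))
      (at_top \<times>\<^sub>F at_left (1::real))"
    unfolding eventually_prod_filter
    by (intro exI[of _ "\<lambda>_::nat. True"] exI[of _ "\<lambda>t::real. 0 < t \<and> t < 1"])
       (auto simp: norm_mult norm_power power_le_one mult_left_le)
  from tannerys_theorem[OF * this assms] show ?thesis
    by (auto simp: eval_fps_def)
qed

text \<open>
  Multiplying by \<open>1 - z X\<close> amounts to a summation by parts: it makes the coefficients absolutely
  summable, so that the conditionally convergent series has its Abel limit as its sum.
\<close>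

lemma abel_limit_geo:
  assumes b: "sqrt_bounded b" and z: "norm z = 1" "z \<noteq> 1"
  defines "h \<equiv> fps_theta_inv (fps_geo z * b)"
  obtains x where "(\<lambda>N. \<Sum>n\<le>N. h $ n) \<longlonglongrightarrow> x"
    "((\<lambda>t. eval_fps h (of_real t)) \<longlongrightarrow> x) (at_left 1)"
proof -
  obtain K where K: "K \<ge> 0" "\<And>n. n > 0 \<Longrightarrow> norm (b $ n) \<le> K / sqrt (real n)"
    using b unfolding sqrt_bounded_def by blast
  obtain C where C: "C \<ge> 0" "\<And>n. norm ((fps_geo z * b) $ n) \<le> C * sqrt (real n)"
    using sqrt_bounded_geo_mult[OF b z(1)] by blast
  have h_nth: "h $ n = (fps_geo z * b) $ n / of_nat n" for n by (simp add: h_def)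
  have h0: "h $ 0 = 0" by (simp add: h_def)
  define e where "e = (1 - fps_const z * fps_X) * h"
  have e0: "e $ 0 = 0" by (simp add: e_def h0)
  have eSuc: "e $ Suc n = h $ Suc n - z * h $ n" for n
    by (simp add: e_def algebra_simps)
  \<comment> \<open>With s_n the coefficients of \<open>fps_geo z * b\<close>, the difference splits
    into z b_n / (n+1) and - z s_n / (n (n+1)). Since b_n is O(n^(-1/2)) and s_n is O(n^(1/2)), both
    are O(n^(-3/2)).\<close>
  have bound: "norm (e $ Suc n) \<le> (K + C) * real n powr (-3/2)" if n: "n > 0" for n
  proof -
    have id: "z * (s + y) / (x + 1) - z * (s / x) = z * y / (x + 1) - z * s / (x * (x + 1))"
      if "x \<noteq> 0" "x + 1 \<noteq> 0" for x s y :: complex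
      using that by (simp add: divide_simps) (simp add: algebra_simps)
    have "e $ Suc n = z * b $ n / of_nat (Suc n) - z * (fps_geo z * b) $ n / (of_nat n * of_nat (Suc n))"
      unfolding eSuc h_nth fps_geo_mult_nth_Suc
      using n id[of "of_nat n" "(fps_geo z * b) $ n" "b $ n"]
      by (simp add: add.commute flip: of_nat_Suc)
    also have "norm \<dots> \<le> norm (b $ n) / real (Suc n) + norm ((fps_geo z * b) $ n) / (real n * real (Suc n))"
      by (rule order.trans[OF norm_triangle_ineq4]) (simp add: norm_mult norm_divide z del: of_nat_Suc)
    also have "\<dots> \<le> (K / sqrt (real n)) / real n + (C * sqrt (real n)) / (real n * real n)"
      using K(1) K(2)[OF n] C n by (intro add_mono frac_le mult_mono) auto
    also have "\<dots> = (K + C) * real n powr (-3/2)"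
    proof -
      have 1: "real n powr (-3/2) = 1 / (real n * sqrt (real n))"
        using n powr_add[of "real n" "-1" "-1/2"]
        by (simp add: powr_minus powr_half_sqrt divide_simps)
      have 2: "sqrt (real n) / (real n * real n) = 1 / (real n * sqrt (real n))"
        using n by (simp add: divide_simps)
      have "K / sqrt (real n) / real n + C * sqrt (real n) / (real n * real n) =
          K * (1 / (real n * sqrt (real n))) + C * (sqrt (real n) / (real n * real n))"
        by simp
      then show ?thesis unfolding 1 2 by (simp only: distrib_right)
    qed
    finally show ?thesis .
  qed
  have "summable (\<lambda>n. (K + C) * real n powr (-3/2))"
    by (intro summable_mult) (simp add: summable_real_powr_iff)
  then have "summable (\<lambda>n. norm (e $ Suc n))"
    by (rule summable_comparison_test'[where N = 1]) (use bound in auto)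
  then have se: "summable (\<lambda>n. norm (e $ n))"
    by (subst (asm) summable_Suc_iff)
  define D where "D = (\<Sum>n. e $ n)"
  \<comment> \<open>As h_N tends to 0 and z is not 1, this relation turns the convergence of the sum
    of e to \<open>D\<close> into that of the sum of h to \<open>D / (1 - z)\<close>.\<close>
  have sum_e: "(\<Sum>n\<le>N. e $ n) = (1 - z) * (\<Sum>n\<le>N. h $ n) + z * h $ N" for N
    by (induction N) (simp_all add: e0 h0 eSuc algebra_simps)
  have "(\<lambda>N. \<Sum>n\<le>N. e $ n) \<longlonglongrightarrow> D"
    using summable_norm_cancel[OF se] unfolding D_def by (rule summable_LIMSEQ')
  moreover have "(\<lambda>N. h $ N) \<longlonglongrightarrow> 0"
  proof -
    have le: "norm (h $ n) \<le> C / sqrt (real n)" if "0 < n" for n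
    proof -
      have "norm (h $ n) \<le> C * sqrt (real n) / real n"
        using C(2)[of n] by (simp add: h_nth norm_divide divide_right_mono)
      also have "\<dots> = C / sqrt (real n)" using that by (simp add: field_simps)
      finally show ?thesis .
    qed
    have lim: "(\<lambda>n. C / sqrt (real n)) \<longlonglongrightarrow> 0"
      by (rule tendsto_divide_0[OF tendsto_const filterlim_at_top_imp_at_infinity[OF
            filterlim_compose[OF sqrt_at_top filterlim_real_sequentially]]])
    show ?thesis
      by (rule Lim_null_comparison[OF eventually_mono[OF eventually_gt_at_top[of 0] le] lim])
  qed
  ultimately have "(\<lambda>N. ((\<Sum>n\<le>N. e $ n) - z * h $ N) / (1 - z)) \<longlonglongrightarrow> (D - z * 0) / (1 - z)"
    using z by (intro tendsto_intros) auto
  then have lim1: "(\<lambda>N. \<Sum>n\<le>N. h $ n) \<longlonglongrightarrow> D / (1 - z)"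
    using z by (simp add: sum_e)
  have rad: "fps_conv_radius h \<ge> 1"
    unfolding h_def by (intro sqrt_bounded_conv_radius sqrt_bounded_theta_inv_geo b z)
  have "eval_fps h (of_real t) = eval_fps e (of_real t) / (1 - z * of_real t)" if t: "0 < t" "t < 1" for t
  proof -
    have "norm (z * of_real t) < 1" using t z by (simp add: norm_mult)
    then have "1 - z * of_real t \<noteq> 0" by (metis eq_iff_diff_eq_0 less_irrefl norm_one)
    moreover have "ereal (norm (complex_of_real t)) < fps_conv_radius h"
      using t by (intro less_le_trans[OF _ rad]) auto
    moreover have "fps_conv_radius (fps_const z * fps_X) = \<infinity>"
      using z by (subst fps_conv_radius_cmult_left) auto
    moreover have "fps_conv_radius (1 - fps_const z * fps_X) = \<infinity>"
      using fps_conv_radius_diff[of 1 "fps_const z * fps_X"] calculation(3) by simp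
    ultimately show ?thesis
      by (simp add: e_def eval_fps_mult eval_fps_diff)
  qed
  moreover have "((\<lambda>t. eval_fps e (of_real t) / (1 - z * of_real t)) \<longlongrightarrow> D / (1 - z * of_real 1)) (at_left 1)"
    unfolding D_def using z by (intro tendsto_intros abel_limit_abs_summable se) auto
  moreover have "eventually (\<lambda>t::real. 0 < t \<and> t < 1) (at_left 1)"
    using eventually_at_left_real[of 0 1] by (auto elim: eventually_mono)
  ultimately have lim2: "((\<lambda>t. eval_fps h (of_real t)) \<longlongrightarrow> D / (1 - z)) (at_left 1)"
    by (subst tendsto_cong[where g = "\<lambda>t. eval_fps e (of_real t) / (1 - z * of_real t)"])
       (auto elim: eventually_mono)
  from that[OF lim1 lim2] show thesis .
qed

text \<open>Every word that arises has leading pair (1, z) with z different from 1, hence is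
  admissible whatever its remaining pairs are. Its nested sum and its Abel limit agree by
  \<open>abel_limit_geo\<close>.\<close>

lemma polylogs_boundary_value:
  assumes L: "L > 0" and z: "z ^ L = 1" "z \<noteq> 1" and g: "g \<in> polylogs L w"
  obtains x where "x \<in> CMZV L (Suc w)"
    "((\<lambda>t. eval_fps (fps_theta_inv (fps_geo z * g)) (of_real t)) \<longlongrightarrow> x) (at_left 1)"
proof -
  let ?lim = "\<lambda>g x. ((\<lambda>t. eval_fps (fps_theta_inv (fps_geo z * g)) (of_real t)) \<longlongrightarrow> x) (at_left 1)"
  have z1: "norm z = 1" using norm_root_of_unity[OF z(1) L] .
  from g polylogs_subset_span[OF L] have "g \<in> rat_fps.span (polylog_fps ` polylog_words L w)" by blast
  \<comment> \<open>The bound on g is carried through the induction because \<open>eval_fps\<close>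
    is additive only inside the disc of convergence.\<close>
  then have "\<exists>x. x \<in> CMZV L (Suc w) \<and> ?lim g x \<and> sqrt_bounded g"
  proof (induction rule: rat_fps.span_induct_alt)
    case base
    then show ?case by (intro exI[of _ 0]) (auto simp: CMZV_def rat_complex.span_zero)
  next
    case (step c f h)
    then obtain azs where azs: "azs \<in> polylog_words L w" "f = polylog_fps azs" by auto
    from step obtain y where y: "y \<in> CMZV L (Suc w)" "?lim h y" "sqrt_bounded h" by blast
    have sf: "sqrt_bounded f" unfolding azs(2) by (rule sqrt_bounded_polylog_fps[OF L azs(1)])
    define azs' where "azs' = (1, z) # twist_word z azs"
    have f': "fps_theta_inv (fps_geo z * f) = polylog_fps azs'"
      unfolding azs(2) azs'_def by (rule fps_theta_inv_geo_polylog) (use z1 in auto)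
    obtain x where x: "(\<lambda>N. \<Sum>n\<le>N. polylog_fps azs' $ n) \<longlonglongrightarrow> x" "?lim f x"
      using abel_limit_geo[OF sf z1 z(2)] unfolding f' by blast
    have "x = cmzv azs'"
      unfolding cmzv_def cmzv_partial_eq_sum[abs_def] using x(1) by (simp add: limI)
    moreover have "cmzv_admissible L azs'" "sum_list (map fst azs') = Suc w"
      using twist_word_in_polylog_words[OF azs(1) z(1)] z
      by (auto simp: polylog_words_def azs'_def cmzv_admissible_def)
    ultimately have "x \<in> CMZV L (Suc w)"
      unfolding CMZV_def by (auto intro!: rat_complex.span_base)
    then have "of_rat c * x + y \<in> CMZV L (Suc w)"
      using y unfolding CMZV_def by (intro rat_complex.span_add rat_complex.span_scale)
    moreover have "?lim (fps_const (of_rat c) * f + h) (of_rat c * x + y)"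
    proof (rule tendsto_cong[THEN iffD1])
      show "((\<lambda>t. of_rat c * eval_fps (fps_theta_inv (fps_geo z * f)) (of_real t) +
          eval_fps (fps_theta_inv (fps_geo z * h)) (of_real t)) \<longlongrightarrow> of_rat c * x + y) (at_left 1)"
        by (intro tendsto_intros x y)
      have "eventually (\<lambda>t::real. 0 < t \<and> t < 1) (at_left 1)"
        using eventually_at_left_real[of 0 1] by (auto elim: eventually_mono)
      then show "eventually (\<lambda>t. of_rat c * eval_fps (fps_theta_inv (fps_geo z * f)) (of_real t) +
          eval_fps (fps_theta_inv (fps_geo z * h)) (of_real t) =
          eval_fps (fps_theta_inv (fps_geo z * (fps_const (of_rat c) * f + h))) (of_real t)) (at_left 1)"
      proof eventually_elim
        case (elim t)
        have rad: "ereal (norm (complex_of_real t)) < fps_conv_radius (fps_theta_inv (fps_geo z * q))"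
          if "sqrt_bounded q" for q
          using elim that by (intro less_le_trans[OF _ sqrt_bounded_conv_radius]
            sqrt_bounded_theta_inv_geo z1) auto
        have radc: "ereal (norm (complex_of_real t)) <
            fps_conv_radius (fps_const (of_rat c) * fps_theta_inv (fps_geo z * f))"
          by (rule less_le_trans[OF _ fps_conv_radius_mult]) (use rad[OF sf] in simp)
        have "fps_theta_inv (fps_geo z * (fps_const (of_rat c) * f + h)) =
            fps_const (of_rat c) * fps_theta_inv (fps_geo z * f) + fps_theta_inv (fps_geo z * h)"
          by (simp add: algebra_simps flip: fps_theta_inv_add fps_theta_inv_const_mult)
        then show ?case
          using rad[OF sf] rad[OF y(3)] radc by (simp add: eval_fps_add eval_fps_mult)
      qed
    qed
    moreover have "sqrt_bounded (fps_const (of_rat c) * f + h)"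
      using sf y by (intro sqrt_bounded_add sqrt_bounded_const_mult)
    ultimately show ?case by blast
  qed
  then show thesis using that by blast
qed

section \<open>Functions of an angle that are polylogarithms in the tangent of its half\<close>

lemma eval_fps_geo:
  fixes z x :: complex
  assumes "norm (z * x) < 1"
  shows "eval_fps (fps_geo z) x = z * x / (1 - z * x)"
proof -
  have "(\<lambda>n. (z * x) * (z * x) ^ n) sums ((z * x) * (1 / (1 - z * x)))"
    by (intro sums_mult geometric_sums assms)
  then have "(\<lambda>n. fps_geo z $ Suc n * x ^ Suc n) sums (z * x / (1 - z * x))"
    by (simp add: power_mult_distrib mult_ac)
  then have "(\<lambda>n. fps_geo z $ n * x ^ n) sums (z * x / (1 - z * x))"
    by (subst (asm) sums_Suc_iff) simp
  then show ?thesis by (simp add: eval_fps_def sums_iff)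
qed

lemma eval_fps_geo_diff:
  fixes z x :: complex
  assumes "norm (z * x) < 1"
  shows "eval_fps (fps_geo z) x - eval_fps (fps_geo (- z)) x = 2 * (z * x) / (1 - (z * x)\<^sup>2)"
proof -
  have "1 - z * x \<noteq> 0" using assms by (metis eq_iff_diff_eq_0 less_irrefl norm_one)
  moreover have "1 + z * x \<noteq> 0"
    using assms by (metis add_eq_0_iff less_irrefl norm_minus_cancel norm_one)
  moreover have "1 - (z * x)\<^sup>2 = (1 - z * x) * (1 + z * x)"
    by (simp add: power2_eq_square algebra_simps)
  ultimately show ?thesis
    using assms by (simp add: eval_fps_geo divide_simps) (simp add: algebra_simps)
qed

lemma eval_fps_geo_add:
  fixes z x :: complex
  assumes "norm (z * x) < 1"
  shows "eval_fps (fps_geo z) x + eval_fps (fps_geo (- z)) x = 2 * (z * x)\<^sup>2 / (1 - (z * x)\<^sup>2)"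
proof -
  have "1 - z * x \<noteq> 0" using assms by (metis eq_iff_diff_eq_0 less_irrefl norm_one)
  moreover have "1 + z * x \<noteq> 0"
    using assms by (metis add_eq_0_iff less_irrefl norm_minus_cancel norm_one)
  moreover have "1 - (z * x)\<^sup>2 = (1 - z * x) * (1 + z * x)"
    by (simp add: power2_eq_square algebra_simps)
  ultimately show ?thesis
    using assms by (simp add: eval_fps_geo divide_simps) (simp add: algebra_simps power2_eq_square)
qed

lemma fps_conv_radius_geo:
  fixes z :: complex
  assumes "norm z = 1"
  shows "fps_conv_radius (fps_geo z) \<ge> 1"
proof (rule fps_conv_radius_ge_1)
  show "norm (fps_geo z $ n) \<le> 1 * (real n + 1)" for n
    using assms by (cases n) (auto simp: norm_mult norm_power)
qed

lemma fps_conv_radius_polylogs: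
  "L > 0 \<Longrightarrow> f \<in> polylogs L w \<Longrightarrow> fps_conv_radius f \<ge> 1"
  by (intro sqrt_bounded_conv_radius sqrt_bounded_polylogs)

text \<open>On [0, pi/2) the variable t = tan (alpha / 2) stays in [0, 1), inside the disc of
  convergence; pi/2 itself is reached only as a limit.\<close>

definition tan_half_polylogs :: "nat \<Rightarrow> (real \<Rightarrow> complex) set" where
  "tan_half_polylogs w =
     {f. \<exists>h\<in>polylogs 4 w. \<forall>\<alpha>\<in>{0..<pi/2}. f \<alpha> = eval_fps h (of_real (tan (\<alpha> / 2)))}"

lemma tan_half_bounds:
  assumes "\<alpha> \<in> {0..<pi/2}"
  shows "0 \<le> tan (\<alpha> / 2)" "tan (\<alpha> / 2) < 1"
proof -
  have "tan 0 \<le> tan (\<alpha> / 2)" using assms by (intro tan_mono_le) auto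
  then show "0 \<le> tan (\<alpha> / 2)" by simp
  have "tan (\<alpha> / 2) < tan (pi / 4)" using assms by (intro tan_monotone) auto
  then show "tan (\<alpha> / 2) < 1" by (simp add: tan_45)
qed

lemma tan_half_in_disc:
  assumes "\<alpha> \<in> {0..<pi/2}" "fps_conv_radius f \<ge> 1"
  shows "ereal (norm (complex_of_real (tan (\<alpha> / 2)))) < fps_conv_radius f"
  using tan_half_bounds[OF assms(1)] by (intro less_le_trans[OF _ assms(2)]) auto

lemma tan_half_polylogs_cong:
  assumes "f \<in> tan_half_polylogs w" "\<And>\<alpha>. \<alpha> \<in> {0..<pi/2} \<Longrightarrow> f \<alpha> = g \<alpha>"
  shows "g \<in> tan_half_polylogs w"
  using assms unfolding tan_half_polylogs_def by auto

lemma tan_half_polylogs_mult: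
  assumes "f \<in> tan_half_polylogs w" "g \<in> tan_half_polylogs v"
  shows "(\<lambda>\<alpha>. f \<alpha> * g \<alpha>) \<in> tan_half_polylogs (w + v)"
proof -
  obtain h k where hk: "h \<in> polylogs 4 w" "k \<in> polylogs 4 v"
    "\<And>\<alpha>. \<alpha> \<in> {0..<pi/2} \<Longrightarrow> f \<alpha> = eval_fps h (of_real (tan (\<alpha> / 2)))"
    "\<And>\<alpha>. \<alpha> \<in> {0..<pi/2} \<Longrightarrow> g \<alpha> = eval_fps k (of_real (tan (\<alpha> / 2)))"
    using assms unfolding tan_half_polylogs_def by blast
  have "f \<alpha> * g \<alpha> = eval_fps (h * k) (of_real (tan (\<alpha> / 2)))" if "\<alpha> \<in> {0..<pi/2}" for \<alpha>
  proof -
    have "ereal (norm (complex_of_real (tan (\<alpha> / 2)))) < fps_conv_radius h"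
      "ereal (norm (complex_of_real (tan (\<alpha> / 2)))) < fps_conv_radius k"
      by (intro tan_half_in_disc[OF that] fps_conv_radius_polylogs[OF _ hk(1)]
        fps_conv_radius_polylogs[OF _ hk(2)]; simp)+
    then show ?thesis using hk(3,4)[OF that] by (simp add: eval_fps_mult)
  qed
  then show ?thesis
    unfolding tan_half_polylogs_def using polylogs_mult[OF hk(1,2)] by blast
qed

lemma tan_half_polylogs_const: "(\<lambda>_. of_rat q) \<in> tan_half_polylogs 0"
  unfolding tan_half_polylogs_def by (auto intro!: exI[of _ "fps_const (of_rat q)"])

lemma tan_half_polylogs_scale:
  "f \<in> tan_half_polylogs w \<Longrightarrow> (\<lambda>\<alpha>. of_rat q * f \<alpha>) \<in> tan_half_polylogs w"
  using tan_half_polylogs_mult[OF tan_half_polylogs_const] by simp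

lemma tan_half_polylogs_power:
  assumes "f \<in> tan_half_polylogs w"
  shows "(\<lambda>\<alpha>. f \<alpha> ^ n) \<in> tan_half_polylogs (n * w)"
proof (induction n)
  case 0
  then show ?case using tan_half_polylogs_const[of 1] by simp
next
  case (Suc n)
  then show ?case using tan_half_polylogs_mult[OF assms Suc] by simp
qed

text \<open>The second part says dt/t = d alpha / sin alpha, the bridge between the two
  variables.\<close>

lemma sin_mult_deriv_tan_half:
  fixes \<alpha> :: real
  assumes "0 \<le> \<alpha>" "\<alpha> < pi/2"
  shows "((\<lambda>\<alpha>. tan (\<alpha> / 2)) has_real_derivative (1 + (tan (\<alpha> / 2))\<^sup>2) / 2) (at \<alpha>)"
    "sin \<alpha> * ((1 + (tan (\<alpha> / 2))\<^sup>2) / 2) = tan (\<alpha> / 2)"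
proof -
  have c: "cos (\<alpha> / 2) \<noteq> 0" using assms by (intro cos_gt_zero_pi less_imp_neq[symmetric]) auto
  have "1 + (tan (\<alpha> / 2))\<^sup>2 = inverse ((cos (\<alpha> / 2))\<^sup>2)"
    using tan_sec[OF c] by (simp add: power_inverse)
  then show "((\<lambda>\<alpha>. tan (\<alpha> / 2)) has_real_derivative (1 + (tan (\<alpha> / 2))\<^sup>2) / 2) (at \<alpha>)"
    using c by (auto intro!: derivative_eq_intros)
  have "1 + (tan (\<alpha> / 2))\<^sup>2 > 0" by (rule add_pos_nonneg) auto
  then show "sin \<alpha> * ((1 + (tan (\<alpha> / 2))\<^sup>2) / 2) = tan (\<alpha> / 2)"
    using sin_tan_half[of "\<alpha> / 2"] by simp
qed

text \<open>Since dt/t = d alpha / sin alpha, composing \<open>fps_theta_inv k\<close> with tan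
  (alpha / 2) gives the derivative k / sin alpha, which is also that of f; both functions vanish at
  0.\<close>

lemma eval_theta_inv_tan_half:
  fixes k :: "complex fps"
  assumes k: "k $ 0 = 0" "fps_conv_radius k \<ge> 1"
    and K: "fps_conv_radius (fps_theta_inv k) \<ge> 1"
    and f0: "f 0 = 0" and cont: "continuous_on {0..<pi/2} f"
    and deriv: "\<And>\<alpha>. 0 < \<alpha> \<Longrightarrow> \<alpha> < pi/2 \<Longrightarrow> (f has_vector_derivative f' \<alpha>) (at \<alpha>)"
    and eq: "\<And>\<alpha>. 0 < \<alpha> \<Longrightarrow> \<alpha> < pi/2 \<Longrightarrow>
      of_real (sin \<alpha>) * f' \<alpha> = eval_fps k (of_real (tan (\<alpha> / 2)))"
    and \<beta>: "\<beta> \<in> {0..<pi/2}"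
  shows "f \<beta> = eval_fps (fps_theta_inv k) (of_real (tan (\<beta> / 2)))"
proof -
  let ?K = "fps_theta_inv k"
  define G where "G = (\<lambda>\<alpha>::real. eval_fps ?K (of_real (tan (\<alpha> / 2))))"
  have G: "(G has_vector_derivative
      of_real ((1 + (tan (\<alpha> / 2))\<^sup>2) / 2) * eval_fps (fps_deriv ?K) (of_real (tan (\<alpha> / 2)))) (at \<alpha>)"
    if "0 \<le> \<alpha>" "\<alpha> < pi/2" for \<alpha>
  proof -
    have "((\<lambda>\<alpha>. complex_of_real (tan (\<alpha> / 2))) has_vector_derivative
        of_real ((1 + (tan (\<alpha> / 2))\<^sup>2) / 2)) (at \<alpha>)"
      using sin_mult_deriv_tan_half(1)[OF that]
      by (intro has_vector_derivative_of_real)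
         (simp add: has_real_derivative_iff_has_vector_derivative)
    moreover have "(eval_fps ?K has_field_derivative
        eval_fps (fps_deriv ?K) (of_real (tan (\<alpha> / 2)))) (at (of_real (tan (\<alpha> / 2))))"
      by (rule has_field_derivative_eval_fps, rule tan_half_in_disc[OF _ K]) (use that in auto)
    ultimately show ?thesis
      unfolding G_def by (rule field_vector_diff_chain_at[unfolded o_def])
  qed
  have f'_eq: "f' \<alpha> = of_real ((1 + (tan (\<alpha> / 2))\<^sup>2) / 2) * eval_fps (fps_deriv ?K) (of_real (tan (\<alpha> / 2)))"
    (is "_ = ?G'") if "0 < \<alpha>" "\<alpha> < pi/2" for \<alpha>
  proof -
    have \<alpha>: "\<alpha> \<in> {0..<pi/2}" using that by auto
    have rd: "fps_conv_radius (fps_deriv ?K) \<ge> 1"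
      using K fps_conv_radius_deriv[of ?K] by (rule order.trans)
    have "of_real (sin \<alpha>) * ?G' = of_real (sin \<alpha> * ((1 + (tan (\<alpha> / 2))\<^sup>2) / 2)) *
        eval_fps (fps_deriv ?K) (of_real (tan (\<alpha> / 2)))"
      by simp
    also have "\<dots> = of_real (tan (\<alpha> / 2)) * eval_fps (fps_deriv ?K) (of_real (tan (\<alpha> / 2)))"
      using that by (subst sin_mult_deriv_tan_half(2)) auto
    also have "\<dots> = eval_fps (fps_X * fps_deriv ?K) (of_real (tan (\<alpha> / 2)))"
      using tan_half_in_disc[OF \<alpha> rd] by (subst eval_fps_mult) auto
    also have "\<dots> = of_real (sin \<alpha>) * f' \<alpha>"
      using eq that by (simp add: fps_theta_theta_inv k)
    finally show ?thesis
      using sin_gt_zero2[of \<alpha>] that by simp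
  qed
  have "f \<beta> - G \<beta> = 0"
  \<comment> \<open>Dividing by sin alpha fails at 0, so the derivative is controlled only at
    positive angles; 0 is the exceptional point, where continuity suffices.\<close>
  proof (rule has_derivative_zero_unique_strong_interval[where k = "{0}" and a = 0 and b = \<beta>
      and f = "\<lambda>\<alpha>. f \<alpha> - G \<alpha>"])
    have "continuous_on {0..\<beta>} G"
      using \<beta> by (intro continuous_at_imp_continuous_on ballI has_vector_derivative_continuous[OF G])
        auto
    then show "continuous_on {0..\<beta>} (\<lambda>\<alpha>. f \<alpha> - G \<alpha>)"
      using \<beta> by (intro continuous_on_diff continuous_on_subset[OF cont]) auto
    show "f 0 - G 0 = 0" by (simp add: f0 G_def eval_fps_at_0 k)
    fix \<alpha> assume "\<alpha> \<in> {0..\<beta>} - {0}"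
    then have \<alpha>: "0 < \<alpha>" "\<alpha> < pi/2" using \<beta> by auto
    have "((\<lambda>\<alpha>. f \<alpha> - G \<alpha>) has_vector_derivative 0) (at \<alpha>)"
      using has_vector_derivative_diff[OF deriv[OF \<alpha>] G[OF less_imp_le[OF \<alpha>(1)] \<alpha>(2)]]
        f'_eq[OF \<alpha>] by simp
    then show "((\<lambda>\<alpha>. f \<alpha> - G \<alpha>) has_derivative (\<lambda>h. 0)) (at \<alpha> within {0..\<beta>})"
      by (auto simp: has_vector_derivative_def intro: has_derivative_at_withinI)
  qed (use \<beta> in auto)
  then show ?thesis by (simp add: G_def)
qed

section \<open>The integration forms in the half-angle variable\<close>

lemma fps_conv_radius_geo_combination:
  fixes h :: "complex fps" and y z :: complex
  assumes "fps_conv_radius h \<ge> 1" "norm z = 1" "norm y = 1"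
  shows "fps_conv_radius ((fps_geo z - fps_geo y) * h) \<ge> 1"
    "fps_conv_radius ((fps_geo z + fps_geo y) * h) \<ge> 1"
    "fps_conv_radius (fps_geo z - fps_geo y) \<ge> 1"
    "fps_conv_radius (fps_geo z + fps_geo y) \<ge> 1"
proof -
  note geo = fps_conv_radius_geo[OF assms(2)] fps_conv_radius_geo[OF assms(3)]
  show 1: "fps_conv_radius (fps_geo z - fps_geo y) \<ge> 1"
    by (rule order.trans[OF _ fps_conv_radius_diff]) (use geo in simp)
  show 2: "fps_conv_radius (fps_geo z + fps_geo y) \<ge> 1"
    by (rule order.trans[OF _ fps_conv_radius_add]) (use geo in simp)
  show "fps_conv_radius ((fps_geo z - fps_geo y) * h) \<ge> 1"
    by (rule order.trans[OF _ fps_conv_radius_mult]) (use 1 assms in simp)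
  show "fps_conv_radius ((fps_geo z + fps_geo y) * h) \<ge> 1"
    by (rule order.trans[OF _ fps_conv_radius_mult]) (use 2 assms in simp)
qed

lemma polylogs_theta_inv_geo_combination:
  assumes "h \<in> polylogs L w" "L > 0" "z ^ L = 1" "y ^ L = 1"
  shows "fps_theta_inv ((fps_geo z - fps_geo y) * h) \<in> polylogs L (Suc w)"
    "fps_theta_inv ((fps_geo z + fps_geo y) * h) \<in> polylogs L (Suc w)"
  using assms unfolding left_diff_distrib distrib_right fps_theta_inv_diff fps_theta_inv_add
  by (auto intro!: polylogs_diff polylogs_add polylogs_theta_inv_geo)

lemma i_power_4: "\<i> ^ 4 = 1" "(- \<i>) ^ 4 = 1"
  by (simp_all add: power4_eq_xxxx)

text \<open>The half-angle formulas. Multiplying a form by sin alpha measures it against dt/t, so i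
  d alpha, cot alpha d alpha and tan alpha d alpha become i sin alpha, cos alpha and (sin alpha)^2 /
  cos alpha. The roots 1 and -1 enter only through the tangent.\<close>

lemma eval_geo_combinations_tan_half:
  fixes \<alpha> :: real
  assumes "0 \<le> \<alpha>" "\<alpha> < pi/2"
  defines "T \<equiv> complex_of_real (tan (\<alpha> / 2))"
  shows "eval_fps (fps_geo \<i> - fps_geo (- \<i>)) T = \<i> * of_real (sin \<alpha>)"
    "1 + eval_fps (fps_geo \<i> + fps_geo (- \<i>)) T = of_real (cos \<alpha>)"
    "eval_fps (fps_geo 1 + fps_geo (- 1)) T - eval_fps (fps_geo \<i> + fps_geo (- \<i>)) T =
       of_real ((sin \<alpha>)\<^sup>2 / cos \<alpha>)"
proof -
  define t where "t = tan (\<alpha> / 2)"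
  have t: "0 \<le> t" "t < 1" using tan_half_bounds[of \<alpha>] assms by (auto simp: t_def)
  have T: "T = of_real t" by (simp add: T_def t_def)
  have T1: "norm T < 1" using t by (simp add: T)
  have rad: "ereal (norm T) < fps_conv_radius (fps_geo z)" if "norm z = 1" for z :: complex
    by (rule less_le_trans[OF _ fps_conv_radius_geo[OF that]]) (use T1 in simp)
  have split: "eval_fps (fps_geo z - fps_geo (- z)) T = eval_fps (fps_geo z) T - eval_fps (fps_geo (- z)) T"
    "eval_fps (fps_geo z + fps_geo (- z)) T = eval_fps (fps_geo z) T + eval_fps (fps_geo (- z)) T"
    if "norm z = 1" for z :: complex
    using rad[of z] rad[of "- z"] that by (simp_all add: eval_fps_diff eval_fps_add)
  have t2: "1 + t\<^sup>2 > 0" by (rule add_pos_nonneg) auto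
  have t2': "1 - t\<^sup>2 > 0" using t power_strict_mono[of t 1 2] by simp
  have c: "cos (\<alpha> / 2) \<noteq> 0" using assms by (intro cos_gt_zero_pi less_imp_neq[symmetric]) auto
  have s: "sin \<alpha> = 2 * t / (1 + t\<^sup>2)" using sin_tan_half[of "\<alpha> / 2"] by (simp add: t_def)
  have co: "cos \<alpha> = (1 - t\<^sup>2) / (1 + t\<^sup>2)" using cos_tan_half[OF c] by (simp add: t_def)
  show "eval_fps (fps_geo \<i> - fps_geo (- \<i>)) T = \<i> * of_real (sin \<alpha>)"
    using eval_fps_geo_diff[of \<i> T] T1
    by (simp add: split norm_mult s) (simp add: T power_mult_distrib)
  have i: "eval_fps (fps_geo \<i> + fps_geo (- \<i>)) T = of_real (- 2 * t\<^sup>2 / (1 + t\<^sup>2))"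
    using eval_fps_geo_add[of \<i> T] T1
    by (simp add: split norm_mult) (simp add: T power_mult_distrib)
  have 1: "eval_fps (fps_geo 1 + fps_geo (- 1)) T = of_real (2 * t\<^sup>2 / (1 - t\<^sup>2))"
    using eval_fps_geo_add[of 1 T] T1
    by (simp add: split norm_mult) (simp add: T power_mult_distrib)
  have "1 + - 2 * t\<^sup>2 / (1 + t\<^sup>2) = cos \<alpha>"
    using t2 by (simp add: co field_simps)
  then show "1 + eval_fps (fps_geo \<i> + fps_geo (- \<i>)) T = of_real (cos \<alpha>)"
    unfolding i by (metis of_real_1 of_real_add)
  have "2 * t\<^sup>2 / (1 - t\<^sup>2) - - 2 * t\<^sup>2 / (1 + t\<^sup>2) = (sin \<alpha>)\<^sup>2 / cos \<alpha>"
    using t2 t2' unfolding s co by (simp add: divide_simps power2_eq_square) (simp add: algebra_simps)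
  then show "eval_fps (fps_geo 1 + fps_geo (- 1)) T - eval_fps (fps_geo \<i> + fps_geo (- \<i>)) T =
       of_real ((sin \<alpha>)\<^sup>2 / cos \<alpha>)"
    unfolding i 1 by (metis of_real_diff)
qed

context
  fixes f f' g :: "real \<Rightarrow> complex" and w :: nat
  assumes f0: "f 0 = 0" and cont: "continuous_on {0..<pi/2} f"
    and deriv: "\<And>\<alpha>. 0 < \<alpha> \<Longrightarrow> \<alpha> < pi/2 \<Longrightarrow> (f has_vector_derivative f' \<alpha>) (at \<alpha>)"
    and g: "g \<in> tan_half_polylogs w"
begin

text \<open>Here and for the cotangent the form contains dt/t, singular at 0; that g vanishes there
  makes the integral converge.\<close>

lemma tan_half_polylogs_integrate_cosec:
  assumes eq: "\<And>\<alpha>. 0 < \<alpha> \<Longrightarrow> \<alpha> < pi/2 \<Longrightarrow> of_real (sin \<alpha>) * f' \<alpha> = g \<alpha>"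
    and g0: "g 0 = 0"
  shows "f \<in> tan_half_polylogs (Suc w)"
proof -
  obtain h where h: "h \<in> polylogs 4 w"
    "\<And>\<alpha>. \<alpha> \<in> {0..<pi/2} \<Longrightarrow> g \<alpha> = eval_fps h (of_real (tan (\<alpha> / 2)))"
    using g unfolding tan_half_polylogs_def by blast
  have h0: "h $ 0 = 0" using h(2)[of 0] g0 by (simp add: eval_fps_at_0)
  have rad: "fps_conv_radius h \<ge> 1" using h by (intro fps_conv_radius_polylogs) auto
  have K: "fps_theta_inv h \<in> polylogs 4 (Suc w)"
    using h h0 by (intro polylogs_theta_inv)
  have "f \<beta> = eval_fps (fps_theta_inv h) (of_real (tan (\<beta> / 2)))" if "\<beta> \<in> {0..<pi/2}" for \<beta>
    by (rule eval_theta_inv_tan_half[OF h0 rad _ f0 cont deriv _ that])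
       (use fps_conv_radius_polylogs[OF _ K] h eq in auto)
  with K show ?thesis unfolding tan_half_polylogs_def by blast
qed

lemma tan_half_polylogs_integrate_cot:
  assumes eq: "\<And>\<alpha>. 0 < \<alpha> \<Longrightarrow> \<alpha> < pi/2 \<Longrightarrow> of_real (sin \<alpha>) * f' \<alpha> = of_real (cos \<alpha>) * g \<alpha>"
    and g0: "g 0 = 0"
  shows "f \<in> tan_half_polylogs (Suc w)"
proof -
  obtain h where h: "h \<in> polylogs 4 w"
    "\<And>\<alpha>. \<alpha> \<in> {0..<pi/2} \<Longrightarrow> g \<alpha> = eval_fps h (of_real (tan (\<alpha> / 2)))"
    using g unfolding tan_half_polylogs_def by blast
  have h0: "h $ 0 = 0" using h(2)[of 0] g0 by (simp add: eval_fps_at_0)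
  have rad: "fps_conv_radius h \<ge> 1" using h by (intro fps_conv_radius_polylogs) auto
  let ?k = "h + (fps_geo \<i> + fps_geo (- \<i>)) * h"
  note geo = fps_conv_radius_geo_combination[OF rad, of \<i> "- \<i>"]
  have radk: "fps_conv_radius ?k \<ge> 1"
    by (rule order.trans[OF _ fps_conv_radius_add]) (use rad geo in simp)
  have K: "fps_theta_inv ?k \<in> polylogs 4 (Suc w)"
    unfolding fps_theta_inv_add using h h0 i_power_4
    by (intro polylogs_add polylogs_theta_inv polylogs_theta_inv_geo_combination) auto
  have "of_real (sin \<alpha>) * f' \<alpha> = eval_fps ?k (of_real (tan (\<alpha> / 2)))"
    if "0 < \<alpha>" "\<alpha> < pi/2" for \<alpha>
  proof -
    let ?T = "complex_of_real (tan (\<alpha> / 2))"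
    have \<alpha>: "\<alpha> \<in> {0..<pi/2}" using that by auto
    have "eval_fps ?k ?T = eval_fps h ?T + eval_fps (fps_geo \<i> + fps_geo (- \<i>)) ?T * eval_fps h ?T"
      using tan_half_in_disc[OF \<alpha> rad] tan_half_in_disc[OF \<alpha> geo(2)] tan_half_in_disc[OF \<alpha> geo(4)]
      by (subst eval_fps_add eval_fps_mult; simp)+
    also have "\<dots> = (1 + eval_fps (fps_geo \<i> + fps_geo (- \<i>)) ?T) * eval_fps h ?T"
      by (simp only: distrib_right mult_1)
    also have "\<dots> = of_real (cos \<alpha>) * g \<alpha>"
      using eval_geo_combinations_tan_half(2)[of \<alpha>] that h(2)[OF \<alpha>] by simp
    finally show ?thesis using eq that by simp
  qed
  then have "f \<beta> = eval_fps (fps_theta_inv ?k) (of_real (tan (\<beta> / 2)))" if "\<beta> \<in> {0..<pi/2}" for \<beta>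
    by (intro eval_theta_inv_tan_half[OF _ radk _ f0 cont deriv _ that])
       (use fps_conv_radius_polylogs[OF _ K] h0 in auto)
  with K show ?thesis unfolding tan_half_polylogs_def by blast
qed

lemma tan_half_polylogs_integrate_tan:
  assumes eq: "\<And>\<alpha>. 0 < \<alpha> \<Longrightarrow> \<alpha> < pi/2 \<Longrightarrow>
      of_real (sin \<alpha>) * f' \<alpha> = of_real ((sin \<alpha>)\<^sup>2 / cos \<alpha>) * g \<alpha>"
  shows "f \<in> tan_half_polylogs (Suc w)"
proof -
  obtain h where h: "h \<in> polylogs 4 w"
    "\<And>\<alpha>. \<alpha> \<in> {0..<pi/2} \<Longrightarrow> g \<alpha> = eval_fps h (of_real (tan (\<alpha> / 2)))"
    using g unfolding tan_half_polylogs_def by blast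
  have rad: "fps_conv_radius h \<ge> 1" using h by (intro fps_conv_radius_polylogs) auto
  let ?k = "(fps_geo 1 + fps_geo (- 1)) * h - (fps_geo \<i> + fps_geo (- \<i>)) * h"
  note geo = fps_conv_radius_geo_combination[OF rad, of \<i> "- \<i>"]
  note geo1 = fps_conv_radius_geo_combination[OF rad, of 1 "- 1"]
  have radk: "fps_conv_radius ?k \<ge> 1"
    by (rule order.trans[OF _ fps_conv_radius_diff]) (use geo geo1 in simp)
  have K: "fps_theta_inv ?k \<in> polylogs 4 (Suc w)"
    unfolding fps_theta_inv_diff using h i_power_4
    by (intro polylogs_diff polylogs_theta_inv_geo_combination) auto
  have "of_real (sin \<alpha>) * f' \<alpha> = eval_fps ?k (of_real (tan (\<alpha> / 2)))"
    if "0 < \<alpha>" "\<alpha> < pi/2" for \<alpha>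
  proof -
    let ?T = "complex_of_real (tan (\<alpha> / 2))"
    have \<alpha>: "\<alpha> \<in> {0..<pi/2}" using that by auto
    have "eval_fps ?k ?T = eval_fps (fps_geo 1 + fps_geo (- 1)) ?T * eval_fps h ?T -
        eval_fps (fps_geo \<i> + fps_geo (- \<i>)) ?T * eval_fps h ?T"
      using tan_half_in_disc[OF \<alpha> rad] tan_half_in_disc[OF \<alpha> geo(2)] tan_half_in_disc[OF \<alpha> geo(4)]
        tan_half_in_disc[OF \<alpha> geo1(2)] tan_half_in_disc[OF \<alpha> geo1(4)]
      by (subst eval_fps_diff eval_fps_mult; simp)+
    also have "\<dots> = of_real ((sin \<alpha>)\<^sup>2 / cos \<alpha>) * g \<alpha>"
      using eval_geo_combinations_tan_half(3)[of \<alpha>] that h(2)[OF \<alpha>]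
      by (simp only: left_diff_distrib[symmetric])
    finally show ?thesis using eq that by simp
  qed
  then have "f \<beta> = eval_fps (fps_theta_inv ?k) (of_real (tan (\<beta> / 2)))" if "\<beta> \<in> {0..<pi/2}" for \<beta>
    by (intro eval_theta_inv_tan_half[OF _ radk _ f0 cont deriv _ that])
       (use fps_conv_radius_polylogs[OF _ K] in auto)
  with K show ?thesis unfolding tan_half_polylogs_def by blast
qed

text \<open>The form involves only the roots i and -i, both different from 1. So the integral has a
  boundary value in \<open>CMZV 4\<close>, even if g itself diverges at pi/2.\<close>

lemma integrate_i_tan_half_polylogs:
  assumes eq: "\<And>\<alpha>. 0 < \<alpha> \<Longrightarrow> \<alpha> < pi/2 \<Longrightarrow> f' \<alpha> = \<i> * g \<alpha>"
  shows "f \<in> tan_half_polylogs (Suc w)" "\<exists>x\<in>CMZV 4 (Suc w). (f \<longlongrightarrow> x) (at_left (pi/2))"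
proof -
  obtain h where h: "h \<in> polylogs 4 w"
    "\<And>\<alpha>. \<alpha> \<in> {0..<pi/2} \<Longrightarrow> g \<alpha> = eval_fps h (of_real (tan (\<alpha> / 2)))"
    using g unfolding tan_half_polylogs_def by blast
  have rad: "fps_conv_radius h \<ge> 1" using h by (intro fps_conv_radius_polylogs) auto
  let ?k = "(fps_geo \<i> - fps_geo (- \<i>)) * h"
  note geo = fps_conv_radius_geo_combination[OF rad, of \<i> "- \<i>"]
  have K: "fps_theta_inv ?k \<in> polylogs 4 (Suc w)"
    using h i_power_4 by (intro polylogs_theta_inv_geo_combination) auto
  have "of_real (sin \<alpha>) * f' \<alpha> = eval_fps ?k (of_real (tan (\<alpha> / 2)))"
    if "0 < \<alpha>" "\<alpha> < pi/2" for \<alpha>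
  proof -
    let ?T = "complex_of_real (tan (\<alpha> / 2))"
    have \<alpha>: "\<alpha> \<in> {0..<pi/2}" using that by auto
    have "eval_fps ?k ?T = eval_fps (fps_geo \<i> - fps_geo (- \<i>)) ?T * eval_fps h ?T"
      using tan_half_in_disc[OF \<alpha> rad] tan_half_in_disc[OF \<alpha> geo(3)] by (intro eval_fps_mult) auto
    also have "\<dots> = of_real (sin \<alpha>) * f' \<alpha>"
      using eval_geo_combinations_tan_half(1)[of \<alpha>] that h(2)[OF \<alpha>] eq[of \<alpha>] by simp
    finally show ?thesis by simp
  qed
  then have f: "f \<beta> = eval_fps (fps_theta_inv ?k) (of_real (tan (\<beta> / 2)))"
    if "\<beta> \<in> {0..<pi/2}" for \<beta>
    by (intro eval_theta_inv_tan_half[OF _ _ _ f0 cont deriv _ that])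
       (use fps_conv_radius_polylogs[OF _ K] geo in auto)
  with K show "f \<in> tan_half_polylogs (Suc w)" unfolding tan_half_polylogs_def by blast
  obtain x where x: "x \<in> CMZV 4 (Suc w)"
    "((\<lambda>t. eval_fps (fps_theta_inv (fps_geo \<i> * h)) (of_real t)) \<longlongrightarrow> x) (at_left 1)"
    using polylogs_boundary_value[OF _ i_power_4(1) _ h(1)] by (auto simp: complex_eq_iff)
  obtain y where y: "y \<in> CMZV 4 (Suc w)"
    "((\<lambda>t. eval_fps (fps_theta_inv (fps_geo (- \<i>) * h)) (of_real t)) \<longlongrightarrow> y) (at_left 1)"
    using polylogs_boundary_value[OF _ i_power_4(2) _ h(1)] by (auto simp: complex_eq_iff)
  have ev: "eventually (\<lambda>\<alpha>. \<alpha> \<in> {0<..<pi/2}) (at_left (pi/2))"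
    using eventually_at_left_real[of 0 "pi/2"] by simp
  have lim: "filterlim (\<lambda>\<alpha>::real. tan (\<alpha> / 2)) (at_left 1) (at_left (pi/2))"
  proof -
    have "((\<lambda>\<alpha>::real. tan (\<alpha> / 2)) \<longlongrightarrow> tan (pi / 2 / 2)) (at_left (pi/2))"
      by (intro tendsto_intros) (auto simp: cos_45)
    moreover have "eventually (\<lambda>\<alpha>::real. tan (\<alpha> / 2) \<in> {..<1} \<and> tan (\<alpha> / 2) \<noteq> 1) (at_left (pi/2))"
      using ev by eventually_elim (use tan_half_bounds in fastforce)
    ultimately show ?thesis by (simp add: filterlim_at tan_45)
  qed
  have "(f \<longlongrightarrow> x - y) (at_left (pi/2))"
  proof (rule tendsto_cong[THEN iffD1])
    show "((\<lambda>\<alpha>. eval_fps (fps_theta_inv (fps_geo \<i> * h)) (of_real (tan (\<alpha> / 2))) -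
        eval_fps (fps_theta_inv (fps_geo (- \<i>) * h)) (of_real (tan (\<alpha> / 2)))) \<longlongrightarrow> x - y) (at_left (pi/2))"
      by (intro tendsto_diff filterlim_compose[OF x(2) lim] filterlim_compose[OF y(2) lim])
    show "eventually (\<lambda>\<alpha>. eval_fps (fps_theta_inv (fps_geo \<i> * h)) (of_real (tan (\<alpha> / 2))) -
        eval_fps (fps_theta_inv (fps_geo (- \<i>) * h)) (of_real (tan (\<alpha> / 2))) = f \<alpha>) (at_left (pi/2))"
      using ev
    proof eventually_elim
      case (elim \<alpha>)
      then have \<alpha>: "\<alpha> \<in> {0..<pi/2}" by auto
      have "fps_conv_radius (fps_theta_inv (fps_geo z * h)) \<ge> 1" if "z ^ 4 = 1" for z
        using that h by (intro fps_conv_radius_polylogs[of 4 _ "Suc w"] polylogs_theta_inv_geo) auto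
      then show ?case
        unfolding f[OF \<alpha>] left_diff_distrib fps_theta_inv_diff using i_power_4
        by (intro eval_fps_diff[symmetric] tan_half_in_disc[OF \<alpha>])
    qed
  qed
  moreover have "x - y \<in> CMZV 4 (Suc w)"
    using x y unfolding CMZV_def by (intro rat_complex.span_diff)
  ultimately show "\<exists>x\<in>CMZV 4 (Suc w). (f \<longlongrightarrow> x) (at_left (pi/2))" by blast
qed

end

section \<open>Sine series\<close>

text \<open>The integral of sin(alpha)^(2n+1) over [0, pi/2]. It serves twice, as this integral and
  as a coefficient of the sine series, which produces the square in the theorem.\<close>

definition wallis :: "nat \<Rightarrow> real" where
  "wallis n = 4 ^ n / real ((2 * n) choose n) / (2 * real n + 1)"

lemma wallis_0 [simp]: "wallis 0 = 1"
  by (simp add: wallis_def)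

lemma wallis_Suc: "wallis (Suc n) = 2 * (real n + 1) / (2 * real n + 3) * wallis n"
proof -
  have w: "wallis m = 4 ^ m * (fact m)\<^sup>2 / fact (2 * m) / (2 * real m + 1)" for m
  proof -
    have "2 * m - m = m" by simp
    then have "real ((2 * m) choose m) = fact (2 * m) / (fact m)\<^sup>2"
      by (subst binomial_fact) (simp_all add: power2_eq_square)
    then show ?thesis by (simp add: wallis_def)
  qed
  define F where "F = (fact (2 * n) :: real)"
  define G where "G = (fact n :: real)"
  define r where "r = real n"
  have F: "F \<noteq> 0" by (simp add: F_def)
  have r: "2 * r + 1 \<noteq> 0" "2 * r + 2 \<noteq> 0" "2 * r + 3 \<noteq> 0" by (auto simp: r_def)
  have f: "fact (2 * Suc n) = (2 * r + 2) * ((2 * r + 1) * F)" "fact (Suc n) = (r + 1) * G"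
    by (simp_all add: F_def G_def r_def algebra_simps)
  have "4 * 4 ^ n * ((r + 1) * G)\<^sup>2 / ((2 * r + 2) * ((2 * r + 1) * F)) / (2 * r + 3) =
      2 * (r + 1) / (2 * r + 3) * (4 ^ n * G\<^sup>2 / F / (2 * r + 1))"
    using F r by (simp add: divide_simps power_mult_distrib) (simp add: power2_eq_square algebra_simps)
  moreover have "2 * real (Suc n) + 1 = 2 * r + 3" by (simp add: r_def)
  ultimately show ?thesis
    by (simp only: w f power_Suc F_def[symmetric] G_def[symmetric] r_def[symmetric])
qed

lemma wallis_pos: "wallis n > 0"
  by (induction n) (auto simp: wallis_Suc)

lemma wallis_le_1: "wallis n \<le> 1"
proof (induction n)
  case (Suc n)
  have "2 * (real n + 1) / (2 * real n + 3) * wallis n \<le> 1 * 1"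
    using Suc wallis_pos[of n] by (intro mult_mono) (auto simp: divide_simps)
  then show ?case by (simp add: wallis_Suc)
qed simp

lemma zeta_twos_nonneg: "zeta_twos n p \<ge> 0"
  unfolding zeta_twos_def by (intro sum_nonneg prod_nonneg) auto

text \<open>Crude, but linear growth of the coefficients already gives a radius of convergence of at
  least 1.\<close>

lemma zeta_twos_le: "zeta_twos n p \<le> real n + 1"
proof (induction n arbitrary: p)
  case 0
  show ?case by (cases p) auto
next
  case (Suc n)
  show ?case
  proof (cases p)
    case (Suc q)
    have "zeta_twos n q / (real n + 1)\<^sup>2 \<le> (real n + 1) / (real n + 1)\<^sup>2"
      using Suc.IH by (intro divide_right_mono) auto
    also have "\<dots> \<le> 1" by (simp add: power2_eq_square divide_simps)
    finally have "zeta_twos n q / (real n + 1)\<^sup>2 \<le> 1" .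
    moreover have "zeta_twos n (Suc q) \<le> real n + 1" by (rule Suc.IH)
    ultimately show ?thesis unfolding Suc zeta_twos_Suc_Suc by linarith
  qed simp
qed

lemmas conv_radius_ge_1_intros =
  order.trans[OF min.boundedI fps_conv_radius_add, of 1]
  order.trans[OF min.boundedI fps_conv_radius_diff, of 1]
  order.trans[OF min.boundedI fps_conv_radius_mult, of 1]
  order.trans[OF _ fps_conv_radius_deriv, of 1]

lemma has_derivative_eval_sin_squared:
  fixes f :: "real fps"
  assumes "fps_conv_radius f \<ge> 1" "\<bar>\<alpha>\<bar> < pi/2"
  shows "((\<lambda>\<alpha>. eval_fps f ((sin \<alpha>)\<^sup>2)) has_real_derivative
     eval_fps (fps_deriv f) ((sin \<alpha>)\<^sup>2) * (2 * sin \<alpha> * cos \<alpha>)) (at \<alpha>)"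
    and "ereal (norm ((sin \<alpha>)\<^sup>2)) < fps_conv_radius f"
proof -
  have "cos \<alpha> > 0" using assms by (intro cos_gt_zero_pi) auto
  then have "(sin \<alpha>)\<^sup>2 < 1" using sin_squared_eq[of \<alpha>] by simp
  then show *: "ereal (norm ((sin \<alpha>)\<^sup>2)) < fps_conv_radius f"
    by (intro less_le_trans[OF _ assms(1)]) auto
  show "((\<lambda>\<alpha>. eval_fps f ((sin \<alpha>)\<^sup>2)) has_real_derivative
     eval_fps (fps_deriv f) ((sin \<alpha>)\<^sup>2) * (2 * sin \<alpha> * cos \<alpha>)) (at \<alpha>)"
    by (rule DERIV_chain2[where f = "eval_fps f" and g = "\<lambda>\<alpha>. (sin \<alpha>)\<^sup>2",
          OF has_field_derivative_eval_fps[OF *]]) (auto intro!: derivative_eq_intros)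
qed

text \<open>Coefficients in the variable (sin alpha)^2; the odd factor sin alpha is split off in
  \<open>sine_series\<close>. The index \<open>j\<close> counts divisions by 2n+1 beyond the one
  inside \<open>wallis\<close>.\<close>

definition sine_coeffs :: "nat \<Rightarrow> nat \<Rightarrow> real fps" where
  "sine_coeffs p j = Abs_fps (\<lambda>n. wallis n * zeta_twos n p / (2 * real n + 1) ^ j)"

definition sine_series :: "nat \<Rightarrow> nat \<Rightarrow> real \<Rightarrow> real" where
  "sine_series p j \<alpha> = sin \<alpha> * eval_fps (sine_coeffs p j) ((sin \<alpha>)\<^sup>2)"

lemma sine_coeffs_nonneg: "sine_coeffs p j $ n \<ge> 0"
  using wallis_pos[of n] zeta_twos_nonneg[of n p] by (simp add: sine_coeffs_def)

lemma conv_radius_sine_coeffs: "fps_conv_radius (sine_coeffs p j) \<ge> 1"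
proof (rule fps_conv_radius_ge_1)
  fix n
  have "wallis n * zeta_twos n p / (2 * real n + 1) ^ j \<le> 1 * (real n + 1) / 1"
    using wallis_pos[of n] wallis_le_1[of n] zeta_twos_nonneg[of n p] zeta_twos_le[of n p]
    by (intro frac_le mult_mono) auto
  then show "norm (sine_coeffs p j $ n) \<le> 1 * (real n + 1)"
    using sine_coeffs_nonneg[of p j n] by (simp add: sine_coeffs_def)
qed

text \<open>The operator 1 + 2 X d/dX is differentiation of s U(s^2) with respect to s, read in the
  variable s^2.\<close>

lemma odd_theta_nth:
  fixes f :: "real fps"
  shows "(f + fps_const 2 * (fps_X * fps_deriv f)) $ n = (2 * real n + 1) * f $ n"
  by (cases n) (simp_all add: algebra_simps)

lemma sine_coeffs_Suc:
  "sine_coeffs p (Suc j) + fps_const 2 * (fps_X * fps_deriv (sine_coeffs p (Suc j))) = sine_coeffs p j"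
proof (rule fps_ext)
  fix n
  have *: "r * (x / (r * y)) = x / y" if "r \<noteq> 0" for r x y :: real
    using that by simp
  have r: "2 * real n + 1 \<noteq> 0" by linarith
  have "(sine_coeffs p (Suc j) + fps_const 2 * (fps_X * fps_deriv (sine_coeffs p (Suc j)))) $ n =
      (2 * real n + 1) * sine_coeffs p (Suc j) $ n"
    by (rule odd_theta_nth)
  also have "\<dots> = sine_coeffs p j $ n"
    unfolding sine_coeffs_def fps_nth_Abs_fps power_Suc by (rule *[OF r])
  finally show "(sine_coeffs p (Suc j) + fps_const 2 * (fps_X * fps_deriv (sine_coeffs p (Suc j)))) $ n =
      sine_coeffs p j $ n" .
qed

lemma eval_sine_combination:
  fixes U :: "real fps"
  assumes "fps_conv_radius U \<ge> 1" "\<bar>\<alpha>\<bar> < pi/2"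
  shows "((\<lambda>\<alpha>. sin \<alpha> * eval_fps U ((sin \<alpha>)\<^sup>2)) has_real_derivative
     cos \<alpha> * eval_fps (U + fps_const 2 * (fps_X * fps_deriv U)) ((sin \<alpha>)\<^sup>2)) (at \<alpha>)"
proof -
  let ?x = "(sin \<alpha>)\<^sup>2"
  have r: "fps_conv_radius (fps_deriv U) \<ge> 1" "fps_conv_radius (fps_X * fps_deriv U) \<ge> 1"
    "fps_conv_radius (fps_const 2 * (fps_X * fps_deriv U)) \<ge> 1"
    using assms(1) by (auto intro!: conv_radius_ge_1_intros)
  note rad = assms(1)[THEN has_derivative_eval_sin_squared(2)[OF _ assms(2)]]
    r[THEN has_derivative_eval_sin_squared(2)[OF _ assms(2)]]
  have "eval_fps (U + fps_const 2 * (fps_X * fps_deriv U)) ?x =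
      eval_fps U ?x + 2 * (?x * eval_fps (fps_deriv U) ?x)"
    using rad by (subst eval_fps_add eval_fps_mult; simp)+
  then show ?thesis
    by (intro DERIV_cong[OF DERIV_mult[OF DERIV_sin has_derivative_eval_sin_squared(1)[OF assms]]])
       (simp add: power2_eq_square algebra_simps)
qed

lemma has_derivative_sine_series:
  assumes "\<bar>\<alpha>\<bar> < pi/2"
  shows "(sine_series p (Suc j) has_real_derivative
    cos \<alpha> * eval_fps (sine_coeffs p j) ((sin \<alpha>)\<^sup>2)) (at \<alpha>)"
  using eval_sine_combination[OF conv_radius_sine_coeffs assms, of p "Suc j"]
  unfolding sine_coeffs_Suc sine_series_def[abs_def] .

text \<open>
  The function \<open>cos \<alpha> * sine_series p 0 \<alpha>\<close> is computed from the differential equation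
  \<open>y\<^sub>p'' = 4 y\<^sub>p\<^sub>-\<^sub>1\<close>; its first derivative is the even series with the following coefficients.
\<close>

definition cosine_coeffs :: "nat \<Rightarrow> real fps" where
  "cosine_coeffs p = (case p of 0 \<Rightarrow> 1 | Suc q \<Rightarrow> fps_integral0 (fps_const 2 * sine_coeffs q 0))"

lemma conv_radius_cosine_coeffs: "fps_conv_radius (cosine_coeffs p) \<ge> 1"
proof (cases p)
  case (Suc q)
  show ?thesis
  proof (rule fps_conv_radius_ge_1)
    fix n
    have b: "\<bar>sine_coeffs q 0 $ m\<bar> \<le> real m + 1" for m
    proof -
      have "wallis m * zeta_twos m q \<le> 1 * (real m + 1)"
        using wallis_pos[of m] wallis_le_1[of m] zeta_twos_nonneg[of m q] zeta_twos_le[of m q]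
        by (intro mult_mono) auto
      then show ?thesis using sine_coeffs_nonneg[of q 0 m] by (simp add: sine_coeffs_def)
    qed
    show "norm (cosine_coeffs p $ n) \<le> 2 * (real n + 1)"
    proof (cases n)
      case (Suc m)
      have "norm (cosine_coeffs p $ n) = 2 * \<bar>sine_coeffs q 0 $ m\<bar> / (real m + 1)"
        by (simp add: cosine_coeffs_def \<open>p = Suc q\<close> Suc fps_integral_def abs_mult divide_inverse add.commute)
      also have "\<dots> \<le> 2 * (real m + 1) / 1"
        using b[of m] by (intro frac_le) auto
      finally show ?thesis using Suc by simp
    qed (simp add: cosine_coeffs_def \<open>p = Suc q\<close> fps_integral_def)
  qed
qed (simp add: cosine_coeffs_def)

text \<open>At X = (sin alpha)^2 this expression is the derivative of cos alpha sin alpha U((sin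
  alpha)^2) with respect to alpha, with (cos alpha)^2 written as 1 - X.\<close>

lemma one_minus_X_odd_theta_nth:
  fixes U :: "real fps"
  shows "((1 - fps_X) * (U + fps_const 2 * (fps_X * fps_deriv U)) - fps_X * U) $ 0 = U $ 0"
    and "((1 - fps_X) * (U + fps_const 2 * (fps_X * fps_deriv U)) - fps_X * U) $ Suc m =
      (2 * real m + 3) * U $ Suc m - (2 * real m + 2) * U $ m"
proof -
  define W where "W = U + fps_const 2 * (fps_X * fps_deriv U)"
  have W: "W $ n = (2 * real n + 1) * U $ n" for n unfolding W_def by (rule odd_theta_nth)
  have "(1 - fps_X) * W = W - fps_X * W" by (simp add: left_diff_distrib)
  then show "((1 - fps_X) * (U + fps_const 2 * (fps_X * fps_deriv U)) - fps_X * U) $ 0 = U $ 0"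
    and "((1 - fps_X) * (U + fps_const 2 * (fps_X * fps_deriv U)) - fps_X * U) $ Suc m =
      (2 * real m + 3) * U $ Suc m - (2 * real m + 2) * U $ m"
    unfolding W_def[symmetric] by (simp_all add: W algebra_simps)
qed

lemma wallis_Suc_mult: "(2 * real m + 3) * wallis (Suc m) = (2 * real m + 2) * wallis m"
proof -
  have "2 * real m + 3 \<noteq> 0" by linarith
  then show ?thesis by (simp add: wallis_Suc divide_simps)
qed

text \<open>By \<open>wallis_Suc_mult\<close> both terms of the coefficient carry the same factor,
  so only the difference of consecutive \<open>zeta_twos\<close> survives. It is the value for p - 1
  divided by (m+1)^2, or 0 if p = 0: this lowers p.\<close>

lemma cosine_coeffs_eq:
  "(1 - fps_X) * (sine_coeffs p 0 + fps_const 2 * (fps_X * fps_deriv (sine_coeffs p 0))) -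
     fps_X * sine_coeffs p 0 = cosine_coeffs p" (is "?lhs = _")
proof (rule fps_ext)
  fix n
  have u: "sine_coeffs p 0 $ n = wallis n * zeta_twos n p" for n p
    by (simp add: sine_coeffs_def)
  show "?lhs $ n = cosine_coeffs p $ n"
  proof (cases n)
    case 0
    show ?thesis unfolding 0 one_minus_X_odd_theta_nth u
      by (cases p) (simp_all add: cosine_coeffs_def fps_integral_def)
  next
    case (Suc m)
    have "?lhs $ n = ((2 * real m + 3) * wallis (Suc m)) * zeta_twos (Suc m) p -
        (2 * real m + 2) * wallis m * zeta_twos m p"
      unfolding Suc one_minus_X_odd_theta_nth u by (simp only: mult.assoc)
    also have "\<dots> = (2 * real m + 2) * wallis m * (zeta_twos (Suc m) p - zeta_twos m p)"
      unfolding wallis_Suc_mult by (simp only: right_diff_distrib)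
    also have "\<dots> = cosine_coeffs p $ n"
    proof (cases p)
      case p: (Suc q)
      have *: "(2 * x + 2) * w * (z / (x + 1)\<^sup>2) = 2 * (w * z) / (x + 1)" if "x \<ge> 0" for x w z :: real
      proof -
        have "2 * y * w * (z / y\<^sup>2) = 2 * (w * z) / y" if "y \<noteq> 0" for y :: real
          using that by (simp add: power2_eq_square)
        from this[of "x + 1"] show ?thesis using that by (simp add: distrib_left)
      qed
      have c: "cosine_coeffs p $ n = 2 * (wallis m * zeta_twos m q) / (real m + 1)"
        by (simp add: p Suc cosine_coeffs_def u fps_integral_def divide_inverse add.commute)
      show ?thesis
        unfolding c unfolding p zeta_twos_Suc_Suc add_diff_cancel_left' by (rule *) simp
    qed (simp add: cosine_coeffs_def Suc)
    finally show ?thesis .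
  qed
qed

lemma has_derivative_cos_sine_series:
  assumes "\<bar>\<alpha>\<bar> < pi/2"
  shows "((\<lambda>\<alpha>. cos \<alpha> * sine_series p 0 \<alpha>) has_real_derivative
    eval_fps (cosine_coeffs p) ((sin \<alpha>)\<^sup>2)) (at \<alpha>)"
proof -
  let ?U = "sine_coeffs p 0" and ?x = "(sin \<alpha>)\<^sup>2"
  let ?W = "?U + fps_const 2 * (fps_X * fps_deriv ?U)"
  have r: "fps_conv_radius ?U \<ge> 1" "fps_conv_radius ?W \<ge> 1" "fps_conv_radius (1 - fps_X :: real fps) \<ge> 1"
    "fps_conv_radius ((1 - fps_X) * ?W) \<ge> 1" "fps_conv_radius (fps_X * ?U) \<ge> 1"
    using conv_radius_sine_coeffs[of p 0] by (auto intro!: conv_radius_ge_1_intros)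
  note rad = r[THEN has_derivative_eval_sin_squared(2)[OF _ assms]]
  have "eval_fps (cosine_coeffs p) ?x = (1 - ?x) * eval_fps ?W ?x - ?x * eval_fps ?U ?x"
    unfolding cosine_coeffs_eq[symmetric] using rad
    by (simp add: eval_fps_diff eval_fps_mult)
  also have "1 - ?x = (cos \<alpha>)\<^sup>2" by (simp add: sin_squared_eq)
  finally show ?thesis
    unfolding sine_series_def
    by (intro DERIV_cong[OF DERIV_mult[OF DERIV_cos eval_sine_combination[OF r(1) assms]]])
       (simp add: power2_eq_square algebra_simps)
qed

lemma has_derivative_eval_cosine_Suc:
  assumes "\<bar>\<alpha>\<bar> < pi/2"
  shows "((\<lambda>\<alpha>. eval_fps (cosine_coeffs (Suc p)) ((sin \<alpha>)\<^sup>2)) has_real_derivative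
    4 * (cos \<alpha> * sine_series p 0 \<alpha>)) (at \<alpha>)"
proof -
  have "fps_deriv (cosine_coeffs (Suc p)) = fps_const 2 * sine_coeffs p 0"
    by (simp add: cosine_coeffs_def fps_deriv_fps_integral)
  moreover have "eval_fps (fps_const 2 * sine_coeffs p 0) ((sin \<alpha>)\<^sup>2) =
      2 * eval_fps (sine_coeffs p 0) ((sin \<alpha>)\<^sup>2)"
    using has_derivative_eval_sin_squared(2)[OF conv_radius_sine_coeffs assms, of p 0]
    by (subst eval_fps_mult) auto
  ultimately show ?thesis
    using has_derivative_eval_sin_squared(1)[OF conv_radius_cosine_coeffs assms, of "Suc p"]
    by (simp add: sine_series_def mult_ac)
qed

section \<open>Closed form of the sine series by repeated integration\<close>

lemma DERIV_eq_on_open_interval: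
  fixes f g :: "real \<Rightarrow> real"
  assumes "\<And>x. \<bar>x\<bar> < c \<Longrightarrow> (f has_real_derivative D x) (at x)"
    "\<And>x. \<bar>x\<bar> < c \<Longrightarrow> (g has_real_derivative D x) (at x)" "f 0 = g 0" "\<bar>x\<bar> < c"
  shows "f x = g x"
proof -
  have "\<exists>C. \<forall>x\<in>{-c<..<c}. f x - g x = C"
  proof (rule has_field_derivative_zero_constant)
    fix x assume "x \<in> {-c<..<c}"
    then have "\<bar>x\<bar> < c" by auto
    from DERIV_diff[OF assms(1,2)[OF this]]
    show "((\<lambda>x. f x - g x) has_real_derivative 0) (at x within {-c<..<c})"
      by (simp add: has_field_derivative_at_within)
  qed simp
  then obtain C where C: "\<And>x. \<bar>x\<bar> < c \<Longrightarrow> f x - g x = C" by (auto simp: abs_less_iff)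
  from C[of x] C[of 0] assms show ?thesis by auto
qed

lemma cos_sine_series:
  assumes "\<bar>\<alpha>\<bar> < pi/2"
  shows "eval_fps (cosine_coeffs p) ((sin \<alpha>)\<^sup>2) = 4 ^ p * \<alpha> ^ (2 * p) / fact (2 * p)"
    and "cos \<alpha> * sine_series p 0 \<alpha> = 4 ^ p * \<alpha> ^ (2 * p + 1) / fact (2 * p + 1)"
proof -
  have pow: "((\<lambda>x. c * x ^ Suc n / fact (Suc n)) has_real_derivative c * x ^ n / fact n) (at x)"
    for c x :: real and n
  proof (rule DERIV_cong[OF DERIV_cdivide[OF DERIV_cmult[OF DERIV_pow]]])
    have "c * (r * y) / (r * f) = c * y / f" if "r \<noteq> 0" for r y f :: real using that by simp
    then show "c * (real (Suc n) * x ^ (Suc n - Suc 0)) / fact (Suc n) = c * x ^ n / fact n"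
      unfolding fact_Suc diff_Suc_Suc diff_zero of_nat_mult by (simp only: of_nat_neq_0 not_False_eq_True)
  qed
  \<comment> \<open>One integration takes the first claim at p to the second at p, and another takes
    that to the first at p + 1; so the induction carries the first claim only.\<close>
  have step: "\<forall>\<alpha>. \<bar>\<alpha>\<bar> < pi/2 \<longrightarrow> cos \<alpha> * sine_series p 0 \<alpha> = 4 ^ p * \<alpha> ^ (2 * p + 1) / fact (2 * p + 1)"
    if "\<And>\<alpha>. \<bar>\<alpha>\<bar> < pi/2 \<Longrightarrow>
      eval_fps (cosine_coeffs p) ((sin \<alpha>)\<^sup>2) = 4 ^ p * \<alpha> ^ (2 * p) / fact (2 * p)" for p
  proof (intro allI impI)
    fix \<alpha> :: real assume "\<bar>\<alpha>\<bar> < pi/2"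
    then show "cos \<alpha> * sine_series p 0 \<alpha> = 4 ^ p * \<alpha> ^ (2 * p + 1) / fact (2 * p + 1)"
    proof (rule DERIV_eq_on_open_interval[where c = "pi/2"
          and f = "\<lambda>\<alpha>. cos \<alpha> * sine_series p 0 \<alpha>"
          and g = "\<lambda>\<alpha>. 4 ^ p * \<alpha> ^ (2 * p + 1) / fact (2 * p + 1)", rotated 3])
      fix \<alpha> :: real assume \<alpha>: "\<bar>\<alpha>\<bar> < pi/2"
      show "((\<lambda>\<alpha>. cos \<alpha> * sine_series p 0 \<alpha>) has_real_derivative
          4 ^ p * \<alpha> ^ (2 * p) / fact (2 * p)) (at \<alpha>)"
        using has_derivative_cos_sine_series[OF \<alpha>, of p] unfolding that[OF \<alpha>] .
      show "((\<lambda>\<alpha>. 4 ^ p * \<alpha> ^ (2 * p + 1) / fact (2 * p + 1)) has_real_derivative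
          4 ^ p * \<alpha> ^ (2 * p) / fact (2 * p)) (at \<alpha>)"
        using pow[of "4 ^ p" "2 * p" \<alpha>] by (simp only: Suc_eq_plus1)
    qed (simp add: sine_series_def)
  qed
  have "\<forall>\<alpha>. \<bar>\<alpha>\<bar> < pi/2 \<longrightarrow>
      eval_fps (cosine_coeffs p) ((sin \<alpha>)\<^sup>2) = 4 ^ p * \<alpha> ^ (2 * p) / fact (2 * p)"
  proof (induction p)
    case 0
    show ?case by (simp add: cosine_coeffs_def)
  next
    case (Suc p)
    have y: "cos \<alpha> * sine_series p 0 \<alpha> = 4 ^ p * \<alpha> ^ (2 * p + 1) / fact (2 * p + 1)"
      if "\<bar>\<alpha>\<bar> < pi/2" for \<alpha>
      using step[of p] Suc that by blast
    show ?case
    proof (intro allI impI)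
      fix \<alpha> :: real assume "\<bar>\<alpha>\<bar> < pi/2"
      then show "eval_fps (cosine_coeffs (Suc p)) ((sin \<alpha>)\<^sup>2) =
          4 ^ Suc p * \<alpha> ^ (2 * Suc p) / fact (2 * Suc p)"
      proof (rule DERIV_eq_on_open_interval[where c = "pi/2"
            and f = "\<lambda>\<alpha>. eval_fps (cosine_coeffs (Suc p)) ((sin \<alpha>)\<^sup>2)"
            and g = "\<lambda>\<alpha>. 4 ^ Suc p * \<alpha> ^ (2 * Suc p) / fact (2 * Suc p)", rotated 3])
        fix \<alpha> :: real assume \<alpha>: "\<bar>\<alpha>\<bar> < pi/2"
        show "((\<lambda>\<alpha>. eval_fps (cosine_coeffs (Suc p)) ((sin \<alpha>)\<^sup>2)) has_real_derivative
            4 ^ Suc p * \<alpha> ^ (2 * p + 1) / fact (2 * p + 1)) (at \<alpha>)"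
          using has_derivative_eval_cosine_Suc[OF \<alpha>, of p] unfolding y[OF \<alpha>]
          by (simp only: power_Suc mult.assoc times_divide_eq_right)
        show "((\<lambda>\<alpha>. 4 ^ Suc p * \<alpha> ^ (2 * Suc p) / fact (2 * Suc p)) has_real_derivative
            4 ^ Suc p * \<alpha> ^ (2 * p + 1) / fact (2 * p + 1)) (at \<alpha>)"
          using pow[of "4 ^ Suc p" "2 * p + 1" \<alpha>]
          by (simp only: Suc_eq_plus1[symmetric] mult_Suc_right add_2_eq_Suc)
      qed (auto simp: eval_fps_at_0 cosine_coeffs_def fps_integral_def)
    qed
  qed
  with step[of p] assms show "eval_fps (cosine_coeffs p) ((sin \<alpha>)\<^sup>2) = 4 ^ p * \<alpha> ^ (2 * p) / fact (2 * p)"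
    "cos \<alpha> * sine_series p 0 \<alpha> = 4 ^ p * \<alpha> ^ (2 * p + 1) / fact (2 * p + 1)"
    by blast+
qed

section \<open>Wallis integrals with logarithms\<close>

text \<open>The coefficient of s^k in cos(alpha)^(-s); because of 1 / k!, differentiation gives tan
  alpha times the function of index k - 1.\<close>

definition log_cos_power :: "nat \<Rightarrow> real \<Rightarrow> real" where
  "log_cos_power k \<alpha> = (- ln (cos \<alpha>)) ^ k / fact k"

lemma log_cos_power_0 [simp]: "log_cos_power 0 \<alpha> = 1"
  by (simp add: log_cos_power_def)

lemma log_cos_power_at_0: "log_cos_power (Suc k) 0 = 0"
  by (simp add: log_cos_power_def)

lemma log_cos_power_nonneg: "\<bar>\<alpha>\<bar> < pi/2 \<Longrightarrow> log_cos_power k \<alpha> \<ge> 0"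
  using cos_gt_zero_pi[of \<alpha>] by (auto simp: log_cos_power_def abs_less_iff)

lemma has_derivative_log_cos_power:
  assumes "\<bar>\<alpha>\<bar> < pi/2"
  shows "(log_cos_power (Suc k) has_real_derivative sin \<alpha> / cos \<alpha> * log_cos_power k \<alpha>) (at \<alpha>)"
proof -
  have c: "cos \<alpha> > 0" using assms by (intro cos_gt_zero_pi) auto
  have L: "((\<lambda>\<alpha>. - ln (cos \<alpha>)) has_real_derivative sin \<alpha> / cos \<alpha>) (at \<alpha>)"
    using c by (auto intro!: derivative_eq_intros simp: divide_inverse)
  have "((\<lambda>\<alpha>. (- ln (cos \<alpha>)) ^ Suc k / fact (Suc k)) has_real_derivative
      (1 + real k) * (sin \<alpha> / cos \<alpha> * (- ln (cos \<alpha>)) ^ k) / fact (Suc k)) (at \<alpha>)"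
    by (rule DERIV_cdivide[OF DERIV_power_Suc[OF L]])
  moreover have "(1 + real k) * (x * y) / fact (Suc k) = x * (y / fact k)" for x y :: real
  proof -
    have "r * (x * y) / (r * f) = x * (y / f)" if "r \<noteq> 0" for r f :: real using that by simp
    moreover have "1 + real k \<noteq> 0" by linarith
    moreover have "fact (Suc k) = (1 + real k) * fact k" by (simp add: algebra_simps)
    ultimately show ?thesis by metis
  qed
  ultimately show ?thesis
    unfolding log_cos_power_def[abs_def] by (simp only:)
qed

text \<open>With c = cos alpha and x = - ln c / 2, a single term of the exponential series gives x^k
  / k! <= exp x = 1 / sqrt c. Hence the product is at most 2^k sqrt c.\<close>

lemma cos_log_cos_power_tendsto_0:
  "((\<lambda>\<alpha>. cos \<alpha> * log_cos_power k \<alpha>) \<longlongrightarrow> 0) (at_left (pi/2))"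
proof (rule Lim_null_comparison)
  have "eventually (\<lambda>\<alpha>::real. \<alpha> \<in> {0<..<pi/2}) (at_left (pi/2))"
    using eventually_at_left_real[of 0 "pi/2"] by simp
  then show "eventually (\<lambda>\<alpha>. norm (cos \<alpha> * log_cos_power k \<alpha>) \<le> 2 ^ k * sqrt (cos \<alpha>)) (at_left (pi/2))"
  proof eventually_elim
    case (elim \<alpha>)
    define c where "c = cos \<alpha>"
    have c: "0 < c" "c \<le> 1" using elim by (auto simp: c_def intro!: cos_gt_zero_pi)
    have l: "0 \<le> - ln c / 2" using c by simp
    have "(- ln c / 2) ^ k / fact k \<le> exp (- ln c / 2)"
    proof -
      have "(\<lambda>n. (- ln c / 2) ^ n /\<^sub>R fact n) sums exp (- ln c / 2)" by (rule exp_converges)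
      then have s: "(\<lambda>n. (- ln c / 2) ^ n / fact n) sums exp (- ln c / 2)"
        by (simp only: real_scaleR_def divide_inverse mult.commute)
      have "(\<Sum>n\<in>{k}. (- ln c / 2) ^ n / fact n) \<le> exp (- ln c / 2)"
        unfolding sums_unique[OF s] using s l by (intro sum_le_suminf) (auto simp: sums_iff)
      then show ?thesis by simp
    qed
    then have "2 ^ k * ((- ln c / 2) ^ k / fact k) \<le> 2 ^ k * exp (- ln c / 2)"
      by (intro mult_left_mono) auto
    also have "2 ^ k * ((- ln c / 2) ^ k / fact k) = (- ln c) ^ k / fact k"
      unfolding times_divide_eq_right power_mult_distrib[symmetric] by simp
    finally have "c * ((- ln c) ^ k / fact k) \<le> c * (2 ^ k * exp (- ln c / 2))"
      using c by (intro mult_left_mono) auto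
    also have "exp (- ln c / 2) = 1 / sqrt c"
    proof -
      have "sqrt c = c powr (1/2)" using c by (simp add: powr_half_sqrt)
      also have "\<dots> = exp (ln c / 2)" using c by (simp add: powr_def)
      finally have "exp (- (ln c / 2)) = 1 / sqrt c" unfolding exp_minus inverse_eq_divide by simp
      then show ?thesis by simp
    qed
    also have "c * (2 ^ k * (1 / sqrt c)) = 2 ^ k * sqrt c"
    proof -
      have "c * (2 ^ k * (1 / sqrt c)) = 2 ^ k * (c / sqrt c)" by simp
      then show ?thesis using c by (simp only: real_div_sqrt less_imp_le)
    qed
    finally have "c * log_cos_power k \<alpha> \<le> 2 ^ k * sqrt c" by (simp add: log_cos_power_def c_def)
    moreover have "0 \<le> c * log_cos_power k \<alpha>"
      using c elim by (intro mult_nonneg_nonneg log_cos_power_nonneg) auto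
    ultimately show ?case by (simp add: c_def)
  qed
  have "((\<lambda>\<alpha>::real. 2 ^ k * sqrt (cos \<alpha>)) \<longlongrightarrow> 2 ^ k * sqrt (cos (pi/2))) (at_left (pi/2))"
    by (intro tendsto_intros)
  then show "((\<lambda>\<alpha>::real. 2 ^ k * sqrt (cos \<alpha>)) \<longlongrightarrow> 0) (at_left (pi/2))" by simp
qed

text \<open>
  An antiderivative of \<open>sin \<alpha> ^ (2 * n + 1) * log_cos_power k \<alpha>\<close>; the recursion integrates by parts.
\<close>

fun wallis_log :: "nat \<Rightarrow> nat \<Rightarrow> real \<Rightarrow> real" where
  "wallis_log 0 0 \<alpha> = 1 - cos \<alpha>"
| "wallis_log 0 (Suc k) \<alpha> = wallis_log 0 k \<alpha> - cos \<alpha> * log_cos_power (Suc k) \<alpha>"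
| "wallis_log (Suc n) 0 \<alpha> =
     ((2 * real n + 2) * wallis_log n 0 \<alpha> - cos \<alpha> * sin \<alpha> ^ (2 * n + 2)) / (2 * real n + 3)"
| "wallis_log (Suc n) (Suc k) \<alpha> =
     ((2 * real n + 2) * wallis_log n (Suc k) \<alpha> + wallis_log (Suc n) k \<alpha>
        - cos \<alpha> * sin \<alpha> ^ (2 * n + 2) * log_cos_power (Suc k) \<alpha>) / (2 * real n + 3)"

lemma wallis_log_at_0 [simp]: "wallis_log n k 0 = 0"
  by (induction n k "0::real" rule: wallis_log.induct) (simp_all add: log_cos_power_at_0)

lemma has_derivative_sin_power_even:
  fixes \<alpha> :: real
  shows "((\<lambda>\<alpha>. sin \<alpha> ^ (2 * n + 2)) has_real_derivative
    (2 * real n + 2) * sin \<alpha> ^ (2 * n + 1) * cos \<alpha>) (at \<alpha>)"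
proof -
  have "2 * n + 2 = Suc (2 * n + 1)" by simp
  moreover have "(1 + real (2 * n + 1)) * (c * x) = (2 * real n + 2) * x * c" for c x :: real by simp
  ultimately show ?thesis
    using DERIV_power_Suc[OF DERIV_sin, where n = "2 * n + 1" and x = \<alpha>] by (simp only:)
qed

lemma has_derivative_wallis_log:
  "\<bar>\<alpha>\<bar> < pi/2 \<Longrightarrow>
    (wallis_log n k has_real_derivative sin \<alpha> ^ (2 * n + 1) * log_cos_power k \<alpha>) (at \<alpha>)"
proof (induction n k \<alpha> rule: wallis_log.induct)
  case (1 \<alpha>)
  show ?case unfolding wallis_log.simps[abs_def] by (auto intro!: derivative_eq_intros)
next
  case (2 k \<alpha>)
  have c: "cos \<alpha> \<noteq> 0" using 2 by (intro cos_gt_zero_pi less_imp_neq[symmetric]) auto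
  have "((\<lambda>\<alpha>. wallis_log 0 k \<alpha> - cos \<alpha> * log_cos_power (Suc k) \<alpha>) has_real_derivative
      sin \<alpha> ^ (2 * 0 + 1) * log_cos_power k \<alpha> -
      (- sin \<alpha> * log_cos_power (Suc k) \<alpha> + sin \<alpha> / cos \<alpha> * log_cos_power k \<alpha> * cos \<alpha>)) (at \<alpha>)"
    using 2 by (intro DERIV_diff DERIV_mult has_derivative_log_cos_power DERIV_cos) auto
  then show ?case unfolding wallis_log.simps[abs_def] using c by simp
next
  case (3 n \<alpha>)
  have "((\<lambda>\<alpha>. ((2 * real n + 2) * wallis_log n 0 \<alpha> - cos \<alpha> * sin \<alpha> ^ (2 * n + 2)) / (2 * real n + 3))
      has_real_derivative ((2 * real n + 2) * (sin \<alpha> ^ (2 * n + 1) * log_cos_power 0 \<alpha>) -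
      (- sin \<alpha> * sin \<alpha> ^ (2 * n + 2) + (2 * real n + 2) * sin \<alpha> ^ (2 * n + 1) * cos \<alpha> * cos \<alpha>))
      / (2 * real n + 3)) (at \<alpha>)"
    using 3 by (intro DERIV_cdivide DERIV_diff DERIV_mult DERIV_cmult DERIV_cos
      has_derivative_sin_power_even) auto
  \<comment> \<open>With S for sin(alpha)^(2n+1) and r for 2n, what remains is a polynomial identity
    modulo cos^2 = 1 - sin^2.\<close>
  moreover have "((r + 2) * (S * L) - (- s * (s * S) + (r + 2) * S * c * c)) / (r + 3) = s * s * S * L"
    if "c * c = 1 - s * s" "r \<ge> 0" "L = 1" for r S L s c :: real
  proof -
    have "(r + 2) * (S * L) - (- s * (s * S) + (r + 2) * S * c * c) =
        (r + 2) * S + s * s * S - (r + 2) * S * (c * c)"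
      using that(3) by (simp add: algebra_simps)
    also have "\<dots> = (r + 3) * (s * s * S * L)"
      unfolding that by (simp add: algebra_simps)
    finally show ?thesis using that(2) by simp
  qed
  from this[of "cos \<alpha>" "sin \<alpha>" "2 * real n" "log_cos_power 0 \<alpha>" "sin \<alpha> ^ (2 * n + 1)"]
  have "((2 * real n + 2) * (sin \<alpha> ^ (2 * n + 1) * log_cos_power 0 \<alpha>) -
      (- sin \<alpha> * sin \<alpha> ^ (2 * n + 2) + (2 * real n + 2) * sin \<alpha> ^ (2 * n + 1) * cos \<alpha> * cos \<alpha>))
      / (2 * real n + 3) = sin \<alpha> ^ (2 * Suc n + 1) * log_cos_power 0 \<alpha>"
    using cos_squared_eq[of \<alpha>] by (simp add: power2_eq_square mult_ac)
  ultimately show ?case unfolding wallis_log.simps[abs_def] by (simp only:)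
next
  case (4 n k \<alpha>)
  have c: "cos \<alpha> \<noteq> 0" using 4 by (intro cos_gt_zero_pi less_imp_neq[symmetric]) auto
  let ?M = "log_cos_power (Suc k) \<alpha>" and ?L = "log_cos_power k \<alpha>"
  have s: "((\<lambda>\<alpha>. cos \<alpha> * sin \<alpha> ^ (2 * n + 2)) has_real_derivative
      - sin \<alpha> * sin \<alpha> ^ (2 * n + 2) + (2 * real n + 2) * sin \<alpha> ^ (2 * n + 1) * cos \<alpha> * cos \<alpha>) (at \<alpha>)"
    by (intro DERIV_mult DERIV_cos has_derivative_sin_power_even)
  have "((\<lambda>\<alpha>. ((2 * real n + 2) * wallis_log n (Suc k) \<alpha> + wallis_log (Suc n) k \<alpha>
        - cos \<alpha> * sin \<alpha> ^ (2 * n + 2) * log_cos_power (Suc k) \<alpha>) / (2 * real n + 3))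
      has_real_derivative ((2 * real n + 2) * (sin \<alpha> ^ (2 * n + 1) * ?M) + sin \<alpha> ^ (2 * Suc n + 1) * ?L -
      ((- sin \<alpha> * sin \<alpha> ^ (2 * n + 2) + (2 * real n + 2) * sin \<alpha> ^ (2 * n + 1) * cos \<alpha> * cos \<alpha>) * ?M
        + sin \<alpha> / cos \<alpha> * ?L * (cos \<alpha> * sin \<alpha> ^ (2 * n + 2))))
      / (2 * real n + 3)) (at \<alpha>)"
    using 4 by (intro DERIV_cdivide DERIV_diff DERIV_add DERIV_mult[OF s]
      DERIV_cmult has_derivative_log_cos_power) auto
  moreover have "((r + 2) * (S * M) + s * s * S * L -
      ((- s * (s * S) + (r + 2) * S * c * c) * M + s / c * L * (c * (s * S)))) / (r + 3) = s * s * S * M"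
    if "c * c = 1 - s * s" "r \<ge> 0" "c \<noteq> 0" for r S L M s c :: real
  proof -
    have "s / c * L * (c * (s * S)) = s * s * S * L" using that(3) by simp
    then have "(r + 2) * (S * M) + s * s * S * L -
        ((- s * (s * S) + (r + 2) * S * c * c) * M + s / c * L * (c * (s * S))) =
        (r + 2) * S * M + s * s * S * M - (r + 2) * S * (c * c) * M"
      by (simp add: algebra_simps)
    also have "\<dots> = (r + 3) * (s * s * S * M)"
      unfolding that by (simp add: algebra_simps)
    finally show ?thesis using that(2) by simp
  qed
  from this[of "cos \<alpha>" "sin \<alpha>" "2 * real n" "sin \<alpha> ^ (2 * n + 1)" ?M ?L]
  have "((2 * real n + 2) * (sin \<alpha> ^ (2 * n + 1) * ?M) + sin \<alpha> ^ (2 * Suc n + 1) * ?L -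
      ((- sin \<alpha> * sin \<alpha> ^ (2 * n + 2) + (2 * real n + 2) * sin \<alpha> ^ (2 * n + 1) * cos \<alpha> * cos \<alpha>) * ?M
        + sin \<alpha> / cos \<alpha> * ?L * (cos \<alpha> * sin \<alpha> ^ (2 * n + 2))))
      / (2 * real n + 3) = sin \<alpha> ^ (2 * Suc n + 1) * ?M"
    using cos_squared_eq[of \<alpha>] c by (simp add: power2_eq_square mult_ac)
  ultimately show ?case unfolding wallis_log.simps[abs_def] by (simp only:)
qed

lemma cos_sin_log_cos_power_tendsto_0:
  "((\<lambda>\<alpha>. cos \<alpha> * sin \<alpha> ^ j * log_cos_power k \<alpha>) \<longlongrightarrow> 0) (at_left (pi/2))"
proof -
  have "((\<lambda>\<alpha>::real. sin \<alpha> ^ j) \<longlongrightarrow> sin (pi/2) ^ j) (at_left (pi/2))"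
    by (intro tendsto_intros)
  from tendsto_mult[OF this cos_log_cos_power_tendsto_0[of k]]
  show ?thesis by (simp add: mult_ac)
qed

text \<open>The boundary terms containing cos alpha vanish in the limit, and the recursion of
  \<open>wallis_log\<close> becomes that of the right-hand side. At n = 0 every limit is 1, the
  value of \<open>t_star_ones 1 k\<close>, whence the index \<open>Suc n\<close>.\<close>

lemma wallis_log_tendsto:
  "(wallis_log n k \<longlongrightarrow> wallis n * t_star_ones (Suc n) k) (at_left (pi/2))"
\<comment> \<open>The value 0 only fills the third slot of the induction rule: the recursion never
  changes the angle.\<close>
proof (induction n k "0::real" rule: wallis_log.induct)
  case 1
  have "((\<lambda>\<alpha>::real. 1 - cos \<alpha>) \<longlongrightarrow> 1 - cos (pi/2)) (at_left (pi/2))"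
    by (intro tendsto_intros)
  then show ?case unfolding wallis_log.simps[abs_def] by simp
next
  case (2 k)
  have "((\<lambda>\<alpha>. wallis_log 0 k \<alpha> - cos \<alpha> * log_cos_power (Suc k) \<alpha>) \<longlongrightarrow>
      wallis 0 * t_star_ones (Suc 0) k - 0) (at_left (pi/2))"
    by (intro tendsto_diff 2 cos_log_cos_power_tendsto_0)
  then show ?case unfolding wallis_log.simps[abs_def] by (simp add: t_star_ones_Suc_Suc)
next
  case (3 n)
  have "((\<lambda>\<alpha>. ((2 * real n + 2) * wallis_log n 0 \<alpha> - cos \<alpha> * sin \<alpha> ^ (2 * n + 2) * log_cos_power 0 \<alpha>)
      / (2 * real n + 3)) \<longlongrightarrow> ((2 * real n + 2) * (wallis n * t_star_ones (Suc n) 0) - 0)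
      / (2 * real n + 3)) (at_left (pi/2))"
    by (intro tendsto_divide tendsto_diff tendsto_mult tendsto_const 3 cos_sin_log_cos_power_tendsto_0) simp
  then show ?case unfolding wallis_log.simps[abs_def] by (simp add: wallis_Suc)
next
  case (4 n k)
  have "((\<lambda>\<alpha>. ((2 * real n + 2) * wallis_log n (Suc k) \<alpha> + wallis_log (Suc n) k \<alpha>
        - cos \<alpha> * sin \<alpha> ^ (2 * n + 2) * log_cos_power (Suc k) \<alpha>) / (2 * real n + 3)) \<longlongrightarrow>
      ((2 * real n + 2) * (wallis n * t_star_ones (Suc n) (Suc k)) +
        wallis (Suc n) * t_star_ones (Suc (Suc n)) k - 0) / (2 * real n + 3)) (at_left (pi/2))"
    by (intro tendsto_divide tendsto_diff tendsto_add tendsto_mult tendsto_const 4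
      cos_sin_log_cos_power_tendsto_0) simp
  also have "((2 * real n + 2) * (wallis n * t_star_ones (Suc n) (Suc k)) +
        wallis (Suc n) * t_star_ones (Suc (Suc n)) k - 0) / (2 * real n + 3) =
      wallis (Suc n) * t_star_ones (Suc (Suc n)) (Suc k)"
  proof -
    have "(2 * real n + 2) * wallis n = (2 * real n + 3) * wallis (Suc n)"
      by (rule wallis_Suc_mult[symmetric])
    then have "(2 * real n + 2) * (wallis n * t_star_ones (Suc n) (Suc k)) =
        (2 * real n + 3) * wallis (Suc n) * t_star_ones (Suc n) (Suc k)"
      by (simp only: mult.assoc[symmetric])
    moreover have "t_star_ones (Suc (Suc n)) (Suc k) =
        t_star_ones (Suc n) (Suc k) + t_star_ones (Suc (Suc n)) k / (2 * real n + 3)"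
      by (subst t_star_ones_Suc_Suc) (simp add: algebra_simps)
    moreover have "(r * w * t + w * u - 0) / r = w * (t + u / r)" if "r \<noteq> 0" for r w t u :: real
      using that by (simp add: field_simps)
    moreover have "2 * real n + 3 \<noteq> 0" by linarith
    ultimately show ?thesis by (simp only:)
  qed
  finally show ?case unfolding wallis_log.simps[abs_def] .
qed

lemma wallis_log_mono:
  assumes "0 \<le> \<alpha>" "\<alpha> \<le> \<beta>" "\<beta> < pi/2"
  shows "wallis_log n k \<alpha> \<le> wallis_log n k \<beta>"
proof (rule DERIV_nonneg_imp_nondecreasing[OF assms(2)])
  fix x assume "\<alpha> \<le> x" "x \<le> \<beta>"
  then have x: "\<bar>x\<bar> < pi/2" "0 \<le> x" using assms by auto
  then have "0 \<le> sin x" by (intro sin_ge_zero) auto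
  then show "\<exists>y. (wallis_log n k has_real_derivative y) (at x) \<and> 0 \<le> y"
    using has_derivative_wallis_log[OF x(1)] log_cos_power_nonneg[OF x(1)] by force
qed

text \<open>Nonnegativity and domination by the limit are what later allows the limit at pi/2 to be
  exchanged with the sum over n.\<close>

lemma wallis_log_bounds:
  assumes "0 \<le> \<beta>" "\<beta> < pi/2"
  shows "0 \<le> wallis_log n k \<beta>" "wallis_log n k \<beta> \<le> wallis n * t_star_ones (Suc n) k"
proof -
  show "0 \<le> wallis_log n k \<beta>" using wallis_log_mono[of 0 \<beta> n k] assms by simp
  have "eventually (\<lambda>\<alpha>. \<alpha> \<in> {\<beta><..<pi/2}) (at_left (pi/2))"
    using assms by (intro eventually_at_left_real) auto
  then have "eventually (\<lambda>\<alpha>. wallis_log n k \<beta> \<le> wallis_log n k \<alpha>) (at_left (pi/2))"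
    by eventually_elim (use assms in \<open>auto intro: wallis_log_mono\<close>)
  then show "wallis_log n k \<beta> \<le> wallis n * t_star_ones (Suc n) k"
    by (rule tendsto_lowerbound[OF wallis_log_tendsto]) simp
qed

section \<open>The series as a boundary value\<close>

lemma sine_series_at_0 [simp]: "sine_series p j 0 = 0"
  by (simp add: sine_series_def)

lemma has_vector_derivative_of_real_real:
  assumes "(f has_real_derivative D) (at x)"
  shows "((\<lambda>x. complex_of_real (f x)) has_vector_derivative complex_of_real D) (at x)"
  using assms by (intro has_vector_derivative_of_real)
    (simp add: has_real_derivative_iff_has_vector_derivative)

lemma continuous_on_of_real_interval:
  assumes "\<And>x. \<bar>x\<bar> < pi/2 \<Longrightarrow> (f has_real_derivative D x) (at x)"
  shows "continuous_on {0..<pi/2} (\<lambda>x. complex_of_real (f x))"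
  by (intro continuous_on_of_real continuous_at_imp_continuous_on ballI DERIV_isCont[OF assms]) auto

text \<open>The factor i is essential: i d alpha is the form for z = i minus the form for z = -i,
  whereas d alpha would require coefficients that are not rational.\<close>

lemma i_angle_tan_half_polylogs: "(\<lambda>\<alpha>. \<i> * complex_of_real \<alpha>) \<in> tan_half_polylogs 1"
proof -
  have "(\<lambda>\<alpha>. \<i> * complex_of_real \<alpha>) \<in> tan_half_polylogs (Suc 0)"
  proof (rule integrate_i_tan_half_polylogs(1))
    show "continuous_on {0..<pi/2} (\<lambda>\<alpha>. \<i> * complex_of_real \<alpha>)"
      by (intro continuous_intros)
    show "((\<lambda>\<alpha>. \<i> * complex_of_real \<alpha>) has_vector_derivative \<i> * 1) (at \<alpha>)" for \<alpha> :: real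
      using has_vector_derivative_mult_right[OF has_vector_derivative_of_real_real[OF DERIV_ident]]
      by simp
    show "(\<lambda>_. 1) \<in> tan_half_polylogs 0"
      using tan_half_polylogs_const[of 1] by simp
  qed auto
  then show ?thesis by simp
qed

lemma of_rat_fact: "of_rat (fact n) = (fact n :: 'a::field_char_0)"
  by (metis of_nat_fact of_rat_of_nat_eq)

text \<open>For k = 1 this integrates tan alpha; the k-th power then has weight k by the shuffle
  product, and 1 / k! is rational.\<close>

lemma log_cos_power_tan_half_polylogs:
  "(\<lambda>\<alpha>. complex_of_real (log_cos_power k \<alpha>)) \<in> tan_half_polylogs k"
proof -
  have "(\<lambda>\<alpha>. complex_of_real (log_cos_power (Suc 0) \<alpha>)) \<in> tan_half_polylogs (Suc 0)"
  proof (rule tan_half_polylogs_integrate_tan)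
    show "continuous_on {0..<pi/2} (\<lambda>\<alpha>. complex_of_real (log_cos_power (Suc 0) \<alpha>))"
      by (rule continuous_on_of_real_interval[OF has_derivative_log_cos_power])
    show "((\<lambda>\<alpha>. complex_of_real (log_cos_power (Suc 0) \<alpha>)) has_vector_derivative
        complex_of_real (sin \<alpha> / cos \<alpha> * log_cos_power 0 \<alpha>)) (at \<alpha>)"
      if "0 < \<alpha>" "\<alpha> < pi/2" for \<alpha>
      using that by (intro has_vector_derivative_of_real_real has_derivative_log_cos_power) auto
    show "(\<lambda>_. 1) \<in> tan_half_polylogs 0"
      using tan_half_polylogs_const[of 1] by simp
  qed (auto simp: log_cos_power_at_0 power2_eq_square)
  from tan_half_polylogs_scale[OF tan_half_polylogs_power[OF this, of k], of "1 / fact k"]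
  show ?thesis
    by (simp add: log_cos_power_def of_rat_divide of_rat_fact)
qed

text \<open>The weight is 2p+1 for alpha^(2p+1), plus 1 for the first division by 2n+1, plus j for
  the others. In the first division, cot alpha times the sine series is alpha^(2p+1) / sin alpha up
  to a constant; later ones integrate against the cotangent.\<close>

lemma sine_series_tan_half_polylogs:
  "(\<lambda>\<alpha>. \<i> * complex_of_real (sine_series p (Suc j) \<alpha>)) \<in> tan_half_polylogs (2 * p + 2 + j)"
proof (induction j)
  case 0
  let ?y = "\<lambda>\<alpha>. cos \<alpha> * sine_series p 0 \<alpha>"
  have "(\<lambda>\<alpha>. \<i> * complex_of_real (sine_series p (Suc 0) \<alpha>)) \<in> tan_half_polylogs (Suc (2 * p + 1))"
  proof (rule tan_half_polylogs_integrate_cosec)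
    show "continuous_on {0..<pi/2} (\<lambda>\<alpha>. \<i> * complex_of_real (sine_series p (Suc 0) \<alpha>))"
      by (intro continuous_on_mult continuous_on_const
        continuous_on_of_real_interval[OF has_derivative_sine_series])
    show "((\<lambda>\<alpha>. \<i> * complex_of_real (sine_series p (Suc 0) \<alpha>)) has_vector_derivative
        \<i> * complex_of_real (cos \<alpha> * eval_fps (sine_coeffs p 0) ((sin \<alpha>)\<^sup>2))) (at \<alpha>)"
      if "0 < \<alpha>" "\<alpha> < pi/2" for \<alpha>
      using that by (intro has_vector_derivative_mult_right has_vector_derivative_of_real_real
        has_derivative_sine_series) auto
    \<comment> \<open>Since i^(2p+1) = (-1)^p i, the sign in \<open>?q\<close> leaves exactly one
      factor i.\<close>
    let ?q = "(- 1) ^ p * 4 ^ p / fact (2 * p + 1) :: rat"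
    have "(\<lambda>\<alpha>. of_rat ?q * (\<i> * complex_of_real \<alpha>) ^ (2 * p + 1)) \<in>
        tan_half_polylogs ((2 * p + 1) * 1)"
      by (intro tan_half_polylogs_scale tan_half_polylogs_power i_angle_tan_half_polylogs)
    then have *: "(\<lambda>\<alpha>. of_rat ?q * (\<i> * complex_of_real \<alpha>) ^ (2 * p + 1)) \<in>
        tan_half_polylogs (2 * p + 1)" by simp
    show "(\<lambda>\<alpha>. \<i> * complex_of_real (?y \<alpha>)) \<in> tan_half_polylogs (2 * p + 1)"
    proof (rule tan_half_polylogs_cong[OF *])
      fix \<alpha> :: real assume "\<alpha> \<in> {0..<pi/2}"
      then have y: "?y \<alpha> = 4 ^ p * \<alpha> ^ (2 * p + 1) / fact (2 * p + 1)"
        by (intro cos_sine_series) auto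
      have i: "\<i> ^ (2 * p + 1) = (- 1) ^ p * \<i>" by (simp add: power_mult)
      have q: "of_rat ?q = (- 1) ^ p * 4 ^ p / (fact (2 * p + 1) :: complex)"
        unfolding of_rat_divide of_rat_mult of_rat_power of_rat_fact by simp
      have "(- 1) ^ p * (- 1) ^ p = (1 :: complex)" by (simp flip: power_mult_distrib)
      then have "of_rat ?q * (\<i> * complex_of_real \<alpha>) ^ (2 * p + 1) =
          4 ^ p * (\<i> * complex_of_real \<alpha> ^ (2 * p + 1)) / fact (2 * p + 1)"
        unfolding q power_mult_distrib i by (simp add: algebra_simps)
      also have "\<dots> = \<i> * complex_of_real (?y \<alpha>)"
        unfolding y by simp
      finally show "of_rat ?q * (\<i> * complex_of_real \<alpha>) ^ (2 * p + 1) = \<i> * complex_of_real (?y \<alpha>)" .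
    qed
  qed (auto simp: sine_series_def)
  then show ?case by simp
next
  case (Suc j)
  have "(\<lambda>\<alpha>. \<i> * complex_of_real (sine_series p (Suc (Suc j)) \<alpha>)) \<in>
      tan_half_polylogs (Suc (2 * p + 2 + j))"
  proof (rule tan_half_polylogs_integrate_cot[OF _ _ _ Suc])
    show "continuous_on {0..<pi/2} (\<lambda>\<alpha>. \<i> * complex_of_real (sine_series p (Suc (Suc j)) \<alpha>))"
      by (intro continuous_on_mult continuous_on_const
        continuous_on_of_real_interval[OF has_derivative_sine_series])
    show "((\<lambda>\<alpha>. \<i> * complex_of_real (sine_series p (Suc (Suc j)) \<alpha>)) has_vector_derivative
        \<i> * complex_of_real (cos \<alpha> * eval_fps (sine_coeffs p (Suc j)) ((sin \<alpha>)\<^sup>2))) (at \<alpha>)"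
      if "0 < \<alpha>" "\<alpha> < pi/2" for \<alpha>
      using that by (intro has_vector_derivative_mult_right has_vector_derivative_of_real_real
        has_derivative_sine_series) auto
  qed (auto simp: sine_series_def)
  then show ?case by simp
qed

section \<open>Termwise integration and exchange of sum and limit\<close>

lemma sums_sine_series:
  assumes "\<bar>\<alpha>\<bar> < pi/2"
  shows "(\<lambda>n. sine_coeffs p j $ n * sin \<alpha> ^ (2 * n + 1)) sums sine_series p j \<alpha>"
proof -
  have "(\<lambda>n. sine_coeffs p j $ n * ((sin \<alpha>)\<^sup>2) ^ n) sums eval_fps (sine_coeffs p j) ((sin \<alpha>)\<^sup>2)"
    using has_derivative_eval_sin_squared(2)[OF conv_radius_sine_coeffs assms, of p j]
    by (rule sums_eval_fps)
  from sums_mult[OF this, of "sin \<alpha>"] show ?thesis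
    by (simp add: sine_series_def power_mult[symmetric] mult_ac)
qed

lemma wallis_log_series:
  assumes "\<bar>\<alpha>\<bar> < pi/2"
  shows "summable (\<lambda>n. sine_coeffs p j $ n * wallis_log n k \<alpha>)"
    and "((\<lambda>\<alpha>. \<Sum>n. sine_coeffs p j $ n * wallis_log n k \<alpha>) has_real_derivative
      sine_series p j \<alpha> * log_cos_power k \<alpha>) (at \<alpha>)"
proof -
  \<comment> \<open>Any b strictly between \<bar>\<alpha>\<bar> and pi/2 would do: on (-b, b) the
    logarithmic factor is bounded by its value at b, and the sine series at b majorizes the
    derivatives of the terms.\<close>
  define b where "b = (\<bar>\<alpha>\<bar> + pi/2) / 2"
  have b: "\<bar>\<alpha>\<bar> < b" "0 < b" "b < pi/2" using assms by (auto simp: b_def)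
  let ?S = "{-b<..<b}"
  let ?f' = "\<lambda>n x. sine_coeffs p j $ n * (sin x ^ (2 * n + 1) * log_cos_power k x)"
  have small: "\<bar>x\<bar> < pi/2" if "x \<in> ?S" for x using that b by auto
  have bound: "norm (?f' n x) \<le> sine_coeffs p j $ n * sin b ^ (2 * n + 1) * log_cos_power k b"
    if "x \<in> ?S" for n x
  proof -
    have "\<bar>sin x\<bar> = sin \<bar>x\<bar>"
      using small[OF that] sin_ge_zero[of "\<bar>x\<bar>"] by (cases "x \<ge> 0") auto
    also have "\<dots> \<le> sin b" using that b by (intro sin_monotone_2pi_le) auto
    finally have s: "\<bar>sin x\<bar> \<le> sin b" .
    have "cos b \<le> cos \<bar>x\<bar>" using that b by (intro cos_monotone_0_pi_le) auto
    moreover have "cos b > 0" using b by (intro cos_gt_zero_pi) auto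
    ultimately have "- ln (cos x) \<le> - ln (cos b)" by simp
    moreover have "0 \<le> - ln (cos x)"
      using cos_gt_zero_pi[of x] small[OF that] by (auto simp: abs_less_iff)
    ultimately have l: "log_cos_power k x \<le> log_cos_power k b"
      unfolding log_cos_power_def by (intro divide_right_mono power_mono) auto
    have "norm (?f' n x) = sine_coeffs p j $ n * \<bar>sin x\<bar> ^ (2 * n + 1) * log_cos_power k x"
      using sine_coeffs_nonneg[of p j n] log_cos_power_nonneg[OF small[OF that], of k]
      by (simp add: abs_mult power_abs)
    also have "\<dots> \<le> sine_coeffs p j $ n * sin b ^ (2 * n + 1) * log_cos_power k b"
      using s l sine_coeffs_nonneg[of p j n] log_cos_power_nonneg[OF small[OF that], of k]
        order.trans[OF abs_ge_zero s]
      by (intro mult_mono mult_left_mono power_mono mult_nonneg_nonneg zero_le_power) auto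
    finally show ?thesis .
  qed
  have "summable (\<lambda>n. sine_coeffs p j $ n * sin b ^ (2 * n + 1) * log_cos_power k b)"
    using sums_sine_series[of b p j] b by (intro summable_mult2) (auto simp: sums_iff)
  then have "uniform_limit ?S (\<lambda>n x. \<Sum>i<n. ?f' i x) (\<lambda>x. \<Sum>i. ?f' i x) sequentially"
    by (rule Weierstrass_m_test[rotated]) (rule bound)
  then have unif: "uniformly_convergent_on ?S (\<lambda>n x. \<Sum>i<n. ?f' i x)"
    unfolding uniformly_convergent_on_def by blast
  have deriv: "((\<lambda>x. sine_coeffs p j $ n * wallis_log n k x) has_field_derivative ?f' n x) (at x within ?S)"
    if "x \<in> ?S" for n x
    by (intro has_field_derivative_at_within[OF DERIV_cmult] has_derivative_wallis_log small that)
  have mem: "0 \<in> ?S" "\<alpha> \<in> interior ?S" using b by (auto simp: abs_less_iff)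
  have s0: "summable (\<lambda>n. sine_coeffs p j $ n * wallis_log n k 0)" by simp
  note series = has_field_derivative_series'[OF convex_real_interval(8) deriv unif mem(1) s0 mem(2)]
  show "summable (\<lambda>n. sine_coeffs p j $ n * wallis_log n k \<alpha>)" by (rule series(1))
  have "(\<lambda>n. ?f' n \<alpha>) sums (sine_series p j \<alpha> * log_cos_power k \<alpha>)"
    using sums_mult2[OF sums_sine_series[OF assms, of p j], of "log_cos_power k \<alpha>"] by (simp add: mult_ac)
  with series(2) show "((\<lambda>\<alpha>. \<Sum>n. sine_coeffs p j $ n * wallis_log n k \<alpha>) has_real_derivative
      sine_series p j \<alpha> * log_cos_power k \<alpha>) (at \<alpha>)"
    by (simp add: sums_iff)
qed

lemma wallis_log_series_boundary:
  obtains X where "complex_of_real X \<in> CMZV 4 (2 * p + 3 + j + k)"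
    "((\<lambda>\<alpha>. \<Sum>n. sine_coeffs p (Suc j) $ n * wallis_log n k \<alpha>) \<longlongrightarrow> X) (at_left (pi/2))"
proof -
  let ?H = "\<lambda>\<alpha>. \<Sum>n. sine_coeffs p (Suc j) $ n * wallis_log n k \<alpha>"
  let ?g = "\<lambda>\<alpha>. \<i> * complex_of_real (sine_series p (Suc j) \<alpha>) * complex_of_real (log_cos_power k \<alpha>)"
  \<comment> \<open>The sum is negated because its integrand i times real is multiplied by the i of
    the outermost form. This last integration adds one to the weight.\<close>
  have "\<exists>x\<in>CMZV 4 (Suc (2 * p + 2 + j + k)). ((\<lambda>\<alpha>. complex_of_real (- ?H \<alpha>)) \<longlongrightarrow> x) (at_left (pi/2))"
  proof (rule integrate_i_tan_half_polylogs(2))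
    show "?g \<in> tan_half_polylogs (2 * p + 2 + j + k)"
      by (intro tan_half_polylogs_mult sine_series_tan_half_polylogs log_cos_power_tan_half_polylogs)
    show "continuous_on {0..<pi/2} (\<lambda>\<alpha>. complex_of_real (- ?H \<alpha>))"
      by (rule continuous_on_of_real_interval[OF DERIV_minus[OF wallis_log_series(2)]])
    show "((\<lambda>\<alpha>. complex_of_real (- ?H \<alpha>)) has_vector_derivative
        complex_of_real (- (sine_series p (Suc j) \<alpha> * log_cos_power k \<alpha>))) (at \<alpha>)"
      if "0 < \<alpha>" "\<alpha> < pi/2" for \<alpha>
      using that by (intro has_vector_derivative_of_real_real DERIV_minus wallis_log_series(2)) auto
  qed (simp_all flip: mult.assoc)
  then obtain x where x: "x \<in> CMZV 4 (2 * p + 3 + j + k)"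
    "((\<lambda>\<alpha>. complex_of_real (- ?H \<alpha>)) \<longlongrightarrow> x) (at_left (pi/2))"
    by (auto simp: eval_nat_numeral)
  \<comment> \<open>The functions are real, so the limit is real as well; the sign is then absorbed
    by the span.\<close>
  have lim: "(?H \<longlongrightarrow> - Re x) (at_left (pi/2))"
    using tendsto_minus[OF tendsto_Re[OF x(2)]] by simp
  then have "((\<lambda>\<alpha>. complex_of_real (- ?H \<alpha>)) \<longlongrightarrow> complex_of_real (- (- Re x))) (at_left (pi/2))"
    by (intro tendsto_intros)
  with x(2) have "x = complex_of_real (- (- Re x))"
    by (intro tendsto_unique[OF trivial_limit_at_left_real])
  then have "complex_of_real (- Re x) = - x" by simp
  moreover have "- x \<in> CMZV 4 (2 * p + 3 + j + k)"
    using x(1) unfolding CMZV_def by (rule rat_complex.span_neg)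
  ultimately show thesis using lim that by metis
qed

lemma shifted_series:
  assumes "m \<ge> 3"
  shows "\<exists>X. (\<lambda>n. (4 ^ n / real ((2 * n) choose n)) ^ 2 * (t_star_ones (Suc n) k * zeta_twos n p)
      / real (2 * n + 1) ^ m) sums X \<and> complex_of_real X \<in> CMZV 4 (m + 2 * p + k)"
proof -
  \<comment> \<open>Of the m factors 2n+1, one lies in each of the two copies of
    \<open>wallis\<close> and one is the extra division in \<open>Suc j\<close>.\<close>
  define j where "j = m - 3"
  have m: "m = j + 3" using assms by (simp add: j_def)
  let ?c = "\<lambda>n. sine_coeffs p (Suc j) $ n" and ?M = "\<lambda>n. wallis n * t_star_ones (Suc n) k"
  let ?H = "\<lambda>\<alpha>. \<Sum>n. ?c n * wallis_log n k \<alpha>"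
  obtain X where X: "complex_of_real X \<in> CMZV 4 (2 * p + 3 + j + k)" "(?H \<longlongrightarrow> X) (at_left (pi/2))"
    by (rule wallis_log_series_boundary)
  have ev: "eventually (\<lambda>\<alpha>. \<alpha> \<in> {0<..<pi/2}) (at_left (pi/2))"
    using eventually_at_left_real[of 0 "pi/2"] by simp
  have M0: "0 \<le> ?M n" for n
    using wallis_log_bounds[of 0 n k] by simp
  \<comment> \<open>Monotone convergence: the terms are nonnegative, so finite sums bound the limit
    from below, while domination by the limits of the terms bounds it from above.\<close>
  have partial: "(\<Sum>n<N. ?c n * ?M n) \<le> X" for N
  proof (rule tendsto_le[OF trivial_limit_at_left_real X(2)])
    show "((\<lambda>\<alpha>. \<Sum>n<N. ?c n * wallis_log n k \<alpha>) \<longlongrightarrow> (\<Sum>n<N. ?c n * ?M n)) (at_left (pi/2))"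
      by (intro tendsto_sum tendsto_mult tendsto_const wallis_log_tendsto)
    show "eventually (\<lambda>\<alpha>. (\<Sum>n<N. ?c n * wallis_log n k \<alpha>) \<le> ?H \<alpha>) (at_left (pi/2))"
      using ev
    proof eventually_elim
      case (elim \<alpha>)
      then show ?case
        using sine_coeffs_nonneg wallis_log_bounds(1)[of \<alpha> _ k]
        by (intro sum_le_suminf wallis_log_series) auto
    qed
  qed
  have summ: "summable (\<lambda>n. ?c n * ?M n)"
    by (rule summableI_nonneg_bounded[OF _ partial]) (intro mult_nonneg_nonneg sine_coeffs_nonneg M0)
  have "(\<Sum>n. ?c n * ?M n) \<le> X"
    by (rule suminf_le_const[OF summ partial])
  moreover have "X \<le> (\<Sum>n. ?c n * ?M n)"
  proof (rule tendsto_upperbound[OF X(2) _ trivial_limit_at_left_real])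
    show "eventually (\<lambda>\<alpha>. ?H \<alpha> \<le> (\<Sum>n. ?c n * ?M n)) (at_left (pi/2))"
      using ev
    proof eventually_elim
      case (elim \<alpha>)
      then show ?case
        using wallis_log_bounds(2)[of \<alpha> _ k]
        by (intro suminf_le mult_left_mono sine_coeffs_nonneg wallis_log_series summ) auto
    qed
  qed
  ultimately have "(\<lambda>n. ?c n * ?M n) sums X"
    using summ by (simp add: sums_iff)
  also have "(\<lambda>n. ?c n * ?M n) = (\<lambda>n. (4 ^ n / real ((2 * n) choose n)) ^ 2 *
      (t_star_ones (Suc n) k * zeta_twos n p) / real (2 * n + 1) ^ m)"
  proof
    fix n
    define r where "r = 2 * real n + 1"
    define A where "A = 4 ^ n / real ((2 * n) choose n)"
    have "r ^ m = r * (r ^ Suc j * r)" by (simp add: m power_add eval_nat_numeral)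
    moreover have "real (2 * n + 1) = r" by (simp add: r_def)
    ultimately show "?c n * ?M n = (4 ^ n / real ((2 * n) choose n)) ^ 2 *
      (t_star_ones (Suc n) k * zeta_twos n p) / real (2 * n + 1) ^ m"
      unfolding sine_coeffs_def wallis_def fps_nth_Abs_fps A_def[symmetric] r_def[symmetric]
      by (simp add: power2_eq_square mult_ac)
  qed
  finally show ?thesis
    using X(1) by (auto simp: m add_ac)
qed

theorem theorem9p17:
  fixes p k m :: nat
  assumes "m \<ge> 3"
  shows "\<exists>S::real.
    (\<lambda>n. (4 ^ n / real ((2 * n) choose n)) ^ 2 * (t_star_ones n k * zeta_twos n p)
           / real (2 * n + 1) ^ m) sums S
    \<and> complex_of_real S \<in> CMZV 4 (m + 2 * p + k)"
proof (cases k)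
  case 0
  then show ?thesis using shifted_series[OF assms, of 0 p] by simp
next
  case (Suc l)
  obtain X where X: "(\<lambda>n. (4 ^ n / real ((2 * n) choose n)) ^ 2 * (t_star_ones (Suc n) k * zeta_twos n p)
      / real (2 * n + 1) ^ m) sums X" "complex_of_real X \<in> CMZV 4 (m + 2 * p + k)"
    using shifted_series[OF assms, of k p] by blast
  \<comment> \<open>In the correction term the exponent m + 1 makes up for the missing entry 1, so
    its weight is again m + 2p + k.\<close>
  have "Suc m \<ge> 3" using assms by simp
  from shifted_series[OF this, of l p] obtain Y where
    Y: "(\<lambda>n. (4 ^ n / real ((2 * n) choose n)) ^ 2 * (t_star_ones (Suc n) l * zeta_twos n p)
      / real (2 * n + 1) ^ Suc m) sums Y" "complex_of_real Y \<in> CMZV 4 (Suc m + 2 * p + l)"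
    by blast
  have "(\<lambda>n. (4 ^ n / real ((2 * n) choose n)) ^ 2 * (t_star_ones n k * zeta_twos n p)
      / real (2 * n + 1) ^ m) sums (X - Y)"
  proof (rule sums_cong[THEN iffD1, OF _ sums_diff[OF X(1) Y(1)]])
    fix n
    have t: "t_star_ones n k = t_star_ones (Suc n) k - t_star_ones (Suc n) l / real (2 * n + 1)"
      unfolding Suc t_star_ones_Suc_Suc by simp
    have "a * (t * z) / r ^ m - a * (u * z) / r ^ Suc m = a * ((t - u / r) * z) / r ^ m"
      for a t z u r :: real
      by (simp add: algebra_simps diff_divide_distrib)
    then show "(4 ^ n / real ((2 * n) choose n)) ^ 2 * (t_star_ones (Suc n) k * zeta_twos n p)
        / real (2 * n + 1) ^ m - (4 ^ n / real ((2 * n) choose n)) ^ 2 *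
        (t_star_ones (Suc n) l * zeta_twos n p) / real (2 * n + 1) ^ Suc m =
      (4 ^ n / real ((2 * n) choose n)) ^ 2 * (t_star_ones n k * zeta_twos n p)
        / real (2 * n + 1) ^ m"
      unfolding t .
  qed
  moreover have "complex_of_real (X - Y) \<in> CMZV 4 (m + 2 * p + k)"
    using X(2) Y(2) unfolding CMZV_def Suc by (auto intro: rat_complex.span_diff)
  ultimately show ?thesis by blast
qed

end
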